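(* Let $K$ be a field of characteristic $0$. Any algebra $(V,\succ,\prec)$ in the variety $\mathrm{Der}\,\mathcal{A}s_2$ can be embedded into an appropriate algebra from the variety $\mathcal{A}s_2^{(d)}$; that is, there exist a second-type associative algebra $A$ with a derivation $d$ and an injective linear map $\varphi:V\to A$ such that $\varphi(a\succ b)=d(\varphi(a))\varphi(b)$ and $\varphi(a\prec b)=\varphi(a)d(\varphi(b))$ for all $a,b\in V$.
   Context: A second-type associative algebra is an associative (not necessarily unital) $K$-algebra satisfying the identity $abc-bac-acb+cab+bca-cba=0$; $\mathcal{A}s_2$ is the variety (and the corresponding quadratic operad) of such algebras, and $\mathcal{A}s_2^{(d)}$ is the variety of $\mathcal{A}s_2$-algebras equipped with a derivation $d$. The operad $\mathrm{Der}\,\mathcal{A}s_2$ is the white Manin product $\mathrm{Nov}\circ\mathcal{A}s_2$ of the Novikov operad with $\mathcal{A}s_2$. Explicitly, $\mathrm{Der}\,\mathcal{A}s_2$ is the variety of $K$-vector spaces with two bilinear operations $\succ,\prec$ satisfying the noncommutative Novikov identities $$x\succ (y\prec z) = (x\succ y)\prec z,$$ $$(x\prec y)\succ z - x\succ (y\succ z) = x\prec (y\succ z) - (x\prec y)\prec z,$$ together with $$(a\succ b)\succ c-a\succ (b\succ c)-(a\succ c)\succ b+a\succ (c\succ b)-(b\prec a)\succ c+b\succ (a\succ c)+b\prec(c\prec a)-(b\prec c)\prec a+(c\prec a)\succ b-c\succ (a\succ b)-c\prec(b\prec a)+(c\prec b)\prec a=0$$ and $$a\succ(b\succ c)-(a\succ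 c)\prec b-b\succ(a\succ c)+(b\succ c)\prec a+(c\prec a)\prec b-(c\prec b)\prec a=0.$$
   Formalization: Der As_2 is taken as the full white product (suboperad of Nov⊗As_2 generated in arity 2): V satisfies all its multilinear identities, not only the four listed, for which the claim is false; in the second, x≺(y≺z) is corrected to x≺(y≻z). *)

theory Defs
  imports Complex_Main "HOL-Library.Poly_Mapping"
begin

section \<open>Second-type associative algebras with a derivation\<close>

locale As2_algebra = vector_space scale
  for scale :: "'k::field \<Rightarrow> 'a::ab_group_add \<Rightarrow> 'a" +
  fixes mult :: "'a \<Rightarrow> 'a \<Rightarrow> 'a"  (infixl \<open>\<cdot>\<close> 70)
  assumes linear_mult_right: "Vector_Spaces.linear scale scale (\<lambda>y. x \<cdot> y)"
    and linear_mult_left: "Vector_Spaces.linear scale scale (\<lambda>x. x \<cdot> y)"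
    and mult_assoc: "(x \<cdot> y) \<cdot> z = x \<cdot> (y \<cdot> z)"
    and second_type:
      "a \<cdot> b \<cdot> c - b \<cdot> a \<cdot> c - a \<cdot> c \<cdot> b + c \<cdot> a \<cdot> b + b \<cdot> c \<cdot> a - c \<cdot> b \<cdot> a = 0"

locale As2_diff_algebra = As2_algebra scale mult
  for scale :: "'k::field \<Rightarrow> 'a::ab_group_add \<Rightarrow> 'a"
    and mult :: "'a \<Rightarrow> 'a \<Rightarrow> 'a"  (infixl \<open>\<cdot>\<close> 70) +
  fixes d :: "'a \<Rightarrow> 'a"
  assumes linear_d: "Vector_Spaces.linear scale scale d"
    and leibniz: "d (x \<cdot> y) = d x \<cdot> y + x \<cdot> d y"

section \<open>Formal linear combinations\<close>

abbreviation mono :: "'x \<Rightarrow> ('x \<Rightarrow>\<^sub>0 'k::zero_neq_one)"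
  where "mono x \<equiv> Poly_Mapping.single x 1"

abbreviation scale_pm :: "'k \<Rightarrow> ('x \<Rightarrow>\<^sub>0 'k) \<Rightarrow> ('x \<Rightarrow>\<^sub>0 'k::field)"
  where "scale_pm c \<equiv> Poly_Mapping.map (\<lambda>y. c * y)"

abbreviation span_pm :: "('x \<Rightarrow>\<^sub>0 'k) set \<Rightarrow> ('x \<Rightarrow>\<^sub>0 'k::field) set"
  where "span_pm \<equiv> module.span scale_pm"

text \<open>The linear extension of \<open>f\<close> to formal linear combinations.\<close>

definition lin_ext ::
    "('k \<Rightarrow> 'a \<Rightarrow> 'a) \<Rightarrow> ('x \<Rightarrow> 'a) \<Rightarrow> ('x \<Rightarrow>\<^sub>0 'k::field) \<Rightarrow> 'a::ab_group_add"
  where "lin_ext scale f p = (\<Sum>x\<in>Poly_Mapping.keys p. scale (Poly_Mapping.lookup p x) (f x))"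

section \<open>The operads Nov and As2\<close>

datatype 'x magma = Gen 'x | Comp "'x magma" "'x magma"  (infixl \<open>\<circ>\<^sub>N\<close> 70)

text \<open>
  The span of \<open>nov_rels\<close> is the kernel of the map from the free nonassociative algebra onto the
  free Novikov algebra. The convention is the one for which \<open>x \<circ> y = x d(y)\<close> makes a commutative
  algebra with derivation \<open>d\<close> a Novikov algebra. As both identities are multilinear, it is
  enough to substitute monomials.
\<close>

inductive_set nov_rels :: "('x magma \<Rightarrow>\<^sub>0 'k::field) set" where
  left_symmetric:
    "mono ((u \<circ>\<^sub>N v) \<circ>\<^sub>N w) - mono (u \<circ>\<^sub>N (v \<circ>\<^sub>N w))
       - mono ((v \<circ>\<^sub>N u) \<circ>\<^sub>N w) + mono (v \<circ>\<^sub>N (u \<circ>\<^sub>N w)) \<in> nov_rels"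
| right_commutative:
    "mono ((u \<circ>\<^sub>N v) \<circ>\<^sub>N w) - mono ((u \<circ>\<^sub>N w) \<circ>\<^sub>N v) \<in> nov_rels"
| mult_left: "p \<in> nov_rels \<Longrightarrow> lin_ext scale_pm (\<lambda>t. mono (u \<circ>\<^sub>N t)) p \<in> nov_rels"
| mult_right: "p \<in> nov_rels \<Longrightarrow> lin_ext scale_pm (\<lambda>t. mono (t \<circ>\<^sub>N u)) p \<in> nov_rels"

text \<open>
  Nonempty words span the free associative algebra without unit. The arguments \<open>u\<close>, \<open>v\<close>, \<open>w\<close> of
  the second-type identity must be nonempty: putting \<open>u = []\<close> would force commutativity.
\<close>

definition as2_rels :: "('x list \<Rightarrow>\<^sub>0 'k::field) set" where
  "as2_rels = {mono (l @ u @ v @ w @ r) - mono (l @ v @ u @ w @ r) - mono (l @ u @ w @ v @ r)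
      + mono (l @ w @ u @ v @ r) + mono (l @ v @ w @ u @ r) - mono (l @ w @ v @ u @ r)
    | l u v w r. u \<noteq> [] \<and> v \<noteq> [] \<and> w \<noteq> []}"

text \<open>
  The kernel of the map from the tensor product of the two free algebras before the identities
  are imposed onto the tensor product of the free Novikov algebra and the free As2-algebra;
  a pair \<open>(t, w)\<close> stands for \<open>t \<otimes> w\<close>. All relations are homogeneous in every generator, so on
  elements multilinear in both factors this is the kernel of the map onto
  \<open>Nov(n) \<otimes> As2(n)\<close>.
\<close>

definition hadamard_kernel :: "('x magma \<times> 'x list \<Rightarrow>\<^sub>0 'k::field) set" where
  "hadamard_kernel = span_pm
     ({lin_ext scale_pm (\<lambda>t. mono (t, w)) p | p w. p \<in> nov_rels \<and> w \<noteq> []}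
      \<union> {lin_ext scale_pm (\<lambda>w. mono (t, w)) q | t q. q \<in> as2_rels})"

section \<open>The white Manin product of Nov and As2\<close>

datatype 'x op_term =
    Var 'x
  | Succ "'x op_term" "'x op_term"  (infixl \<open>\<succ>\<^sub>T\<close> 70)
  | Prec "'x op_term" "'x op_term"  (infixl \<open>\<prec>\<^sub>T\<close> 70)

text \<open>
  The white product is the suboperad of the Hadamard product generated by
  \<open>Nov(2) \<otimes> As2(2)\<close>, that is, by \<open>x \<succ> y = (y \<circ> x) \<otimes> xy\<close> and \<open>x \<prec> y = (x \<circ> y) \<otimes> xy\<close>. These are
  \<open>d(x)y\<close> and \<open>x d(y)\<close> when \<open>x \<circ> y\<close> is read as \<open>x d(y)\<close>.
\<close>

primrec nov_part :: "'x op_term \<Rightarrow> 'x magma" where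
  "nov_part (Var x) = Gen x"
| "nov_part (s \<succ>\<^sub>T t) = nov_part t \<circ>\<^sub>N nov_part s"
| "nov_part (s \<prec>\<^sub>T t) = nov_part s \<circ>\<^sub>N nov_part t"

primrec word_part :: "'x op_term \<Rightarrow> 'x list" where
  "word_part (Var x) = [x]"
| "word_part (s \<succ>\<^sub>T t) = word_part s @ word_part t"
| "word_part (s \<prec>\<^sub>T t) = word_part s @ word_part t"

definition multilinear :: "nat \<Rightarrow> (nat op_term \<Rightarrow>\<^sub>0 'k::field) \<Rightarrow> bool" where
  "multilinear n f \<longleftrightarrow>
     (\<forall>t\<in>Poly_Mapping.keys f. distinct (word_part t) \<and> set (word_part t) = {..<n})"

definition white_identity :: "(nat op_term \<Rightarrow>\<^sub>0 'k::field) \<Rightarrow> bool" where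
  "white_identity f \<longleftrightarrow> (\<exists>n. multilinear n f) \<and>
     lin_ext scale_pm (\<lambda>t. mono (nov_part t, word_part t)) f \<in> hadamard_kernel"

primrec eval_term :: "('a \<Rightarrow> 'a \<Rightarrow> 'a) \<Rightarrow> ('a \<Rightarrow> 'a \<Rightarrow> 'a) \<Rightarrow> ('x \<Rightarrow> 'a) \<Rightarrow> 'x op_term \<Rightarrow> 'a" where
  "eval_term succ prec \<rho> (Var x) = \<rho> x"
| "eval_term succ prec \<rho> (s \<succ>\<^sub>T t) = succ (eval_term succ prec \<rho> s) (eval_term succ prec \<rho> t)"
| "eval_term succ prec \<rho> (s \<prec>\<^sub>T t) = prec (eval_term succ prec \<rho> s) (eval_term succ prec \<rho> t)"

text \<open>
  A relation of the suboperad is a multilinear combination of terms that vanishes in the Hadamard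
  product. The identities of degree three derived at the end of this theory do not imply all of
  these relations. For example, let \<open>V\<close> have the basis \<open>a\<close>, \<open>e i j\<close> (\<open>i, j \<ge> 0\<close>), the products
  \<open>a \<prec> e i j = e (i+1) j\<close> and \<open>e i j \<succ> a = e i (j+1)\<close>, and all other products zero. It
  satisfies the identities of degree three, but has no embedding into an As2-algebra with
  derivation, since there \<open>e 1 2 - e 2 1\<close> becomes the second-type identity at \<open>aa\<close>, \<open>a\<close>,
  \<open>d(d(d(e 0 0)))\<close>.
\<close>

locale Der_As2_algebra = vector_space scale
  for scale :: "'k::field \<Rightarrow> 'v::ab_group_add \<Rightarrow> 'v" +
  fixes succ :: "'v \<Rightarrow> 'v \<Rightarrow> 'v"  (infixl \<open>\<succ>\<close> 70)
    and prec :: "'v \<Rightarrow> 'v \<Rightarrow> 'v"  (infixl \<open>\<prec>\<close> 70)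
  assumes linear_succ_right: "Vector_Spaces.linear scale scale (\<lambda>y. x \<succ> y)"
    and linear_succ_left: "Vector_Spaces.linear scale scale (\<lambda>x. x \<succ> y)"
    and linear_prec_right: "Vector_Spaces.linear scale scale (\<lambda>y. x \<prec> y)"
    and linear_prec_left: "Vector_Spaces.linear scale scale (\<lambda>x. x \<prec> y)"
    and white: "white_identity f \<Longrightarrow> lin_ext scale (eval_term succ prec \<rho>) f = 0"

section \<open>The space underlying the enveloping algebra\<close>

text \<open>
  HOL cannot quantify over types inside a formula, so the enveloping algebra needs a fixed type:
  combinations of words in the formal derivatives \<open>(v, k)\<close>, standing for \<open>d\<^sup>k(v)\<close>, of the elements
  of \<open>'v\<close>. The choice costs no generality. If \<open>'v\<close> embeds into an algebra of any size, it embeds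
  into the differential subalgebra it generates, whose dimension is at most the number of words,
  and the direct sum with a space with zero product and zero derivation brings the dimension up
  to the number of words.
\<close>

type_synonym ('k, 'v) envelope = "('v \<times> nat) list \<Rightarrow>\<^sub>0 'k"

section \<open>The identities of degree three\<close>

lemma module_scale_pm: "module (scale_pm :: 'k \<Rightarrow> ('x \<Rightarrow>\<^sub>0 'k) \<Rightarrow> _ \<Rightarrow>\<^sub>0 'k::field)"
proof -
  have *: "Poly_Mapping.lookup (Poly_Mapping.map g p) x = g (Poly_Mapping.lookup p x)"
    if "g 0 = 0" for g and p :: "'x \<Rightarrow>\<^sub>0 'k" and x
    using that by (simp add: Poly_Mapping.map.rep_eq when_def)
  then show ?thesis
    by unfold_locales (auto intro!: poly_mapping_eqI simp: * lookup_add algebra_simps)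
qed

lemma lin_ext_add:
  assumes "module scale"
  shows "lin_ext scale f (p + q) = lin_ext scale f p + lin_ext scale f q"
proof -
  interpret module scale by fact
  let ?A = "Poly_Mapping.keys p \<union> Poly_Mapping.keys q"
  have *: "lin_ext scale f r = (\<Sum>x\<in>?A. scale (Poly_Mapping.lookup r x) (f x))"
    if "Poly_Mapping.keys r \<subseteq> ?A" for r
    unfolding lin_ext_def using that by (intro sum.mono_neutral_left) (auto simp: in_keys_iff)
  show ?thesis
    by (simp add: * keys_add lookup_add scale_left_distrib sum.distrib)
qed

lemma lin_ext_diff:
  assumes "module scale"
  shows "lin_ext scale f (p - q) = lin_ext scale f p - lin_ext scale f q"
  using lin_ext_add[OF assms, of f "p - q" q] by (simp add: algebra_simps)

lemma lin_ext_mono: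
  assumes "module scale"
  shows "lin_ext scale f (mono x) = f x"
proof -
  interpret module scale by fact
  show ?thesis by (simp add: lin_ext_def)
qed

lemmas lin_ext_simps = lin_ext_add lin_ext_diff lin_ext_mono

lemma multilinear_add: "multilinear n f \<Longrightarrow> multilinear n g \<Longrightarrow> multilinear n (f + g)"
  using keys_add[of f g] unfolding multilinear_def by blast

lemma multilinear_diff: "multilinear n f \<Longrightarrow> multilinear n g \<Longrightarrow> multilinear n (f - g)"
  using keys_diff[of f g] unfolding multilinear_def by blast

lemma multilinear_mono:
  "distinct (word_part t) \<Longrightarrow> set (word_part t) = {..<n} \<Longrightarrow> multilinear n (mono t)"
  by (simp add: multilinear_def)

lemmas multilinear_intros = multilinear_add multilinear_diff multilinear_mono

lemma hadamard_kernel_add: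
  "p \<in> hadamard_kernel \<Longrightarrow> q \<in> hadamard_kernel \<Longrightarrow> p + q \<in> hadamard_kernel"
  unfolding hadamard_kernel_def by (rule module.span_add[OF module_scale_pm])

lemma hadamard_kernel_diff:
  "p \<in> hadamard_kernel \<Longrightarrow> q \<in> hadamard_kernel \<Longrightarrow> p - q \<in> hadamard_kernel"
  unfolding hadamard_kernel_def by (rule module.span_diff[OF module_scale_pm])

abbreviation left_symmetric_at ::
    "'x magma \<Rightarrow> 'x magma \<Rightarrow> 'x magma \<Rightarrow> 'x list \<Rightarrow> ('x magma \<times> 'x list \<Rightarrow>\<^sub>0 'k::field)"
  where "left_symmetric_at u v w x \<equiv>
    mono ((u \<circ>\<^sub>N v) \<circ>\<^sub>N w, x) - mono (u \<circ>\<^sub>N (v \<circ>\<^sub>N w), x)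
      - mono ((v \<circ>\<^sub>N u) \<circ>\<^sub>N w, x) + mono (v \<circ>\<^sub>N (u \<circ>\<^sub>N w), x)"

abbreviation right_commutative_at ::
    "'x magma \<Rightarrow> 'x magma \<Rightarrow> 'x magma \<Rightarrow> 'x list \<Rightarrow> ('x magma \<times> 'x list \<Rightarrow>\<^sub>0 'k::field)"
  where "right_commutative_at u v w x \<equiv>
    mono ((u \<circ>\<^sub>N v) \<circ>\<^sub>N w, x) - mono ((u \<circ>\<^sub>N w) \<circ>\<^sub>N v, x)"

abbreviation second_type_at ::
    "'x magma \<Rightarrow> 'x \<Rightarrow> 'x \<Rightarrow> 'x \<Rightarrow> ('x magma \<times> 'x list \<Rightarrow>\<^sub>0 'k::field)"
  where "second_type_at t a b c \<equiv>
    mono (t, [a,b,c]) - mono (t, [b,a,c]) - mono (t, [a,c,b])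
      + mono (t, [c,a,b]) + mono (t, [b,c,a]) - mono (t, [c,b,a])"

lemma left_symmetric_at_kernel:
  assumes "x \<noteq> []"
  shows "left_symmetric_at u v w x \<in> (hadamard_kernel :: (_ \<Rightarrow>\<^sub>0 'k::field) set)"
proof -
  let ?p = "mono ((u \<circ>\<^sub>N v) \<circ>\<^sub>N w) - mono (u \<circ>\<^sub>N (v \<circ>\<^sub>N w))
       - mono ((v \<circ>\<^sub>N u) \<circ>\<^sub>N w) + mono (v \<circ>\<^sub>N (u \<circ>\<^sub>N w)) :: _ \<Rightarrow>\<^sub>0 'k"
  have "lin_ext scale_pm (\<lambda>t. mono (t, x)) ?p \<in> (hadamard_kernel :: (_ \<Rightarrow>\<^sub>0 'k) set)"
    unfolding hadamard_kernel_def
    by (rule module.span_base[OF module_scale_pm]) (use assms nov_rels.left_symmetric in blast)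
  then show ?thesis by (simp add: lin_ext_simps[OF module_scale_pm])
qed

lemma right_commutative_at_kernel:
  assumes "x \<noteq> []"
  shows "right_commutative_at u v w x \<in> (hadamard_kernel :: (_ \<Rightarrow>\<^sub>0 'k::field) set)"
proof -
  let ?p = "mono ((u \<circ>\<^sub>N v) \<circ>\<^sub>N w) - mono ((u \<circ>\<^sub>N w) \<circ>\<^sub>N v) :: _ \<Rightarrow>\<^sub>0 'k"
  have "lin_ext scale_pm (\<lambda>t. mono (t, x)) ?p \<in> (hadamard_kernel :: (_ \<Rightarrow>\<^sub>0 'k) set)"
    unfolding hadamard_kernel_def
    by (rule module.span_base[OF module_scale_pm]) (use assms nov_rels.right_commutative in blast)
  then show ?thesis by (simp add: lin_ext_simps[OF module_scale_pm])
qed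

lemma second_type_at_kernel:
  "second_type_at t a b c \<in> (hadamard_kernel :: (_ \<Rightarrow>\<^sub>0 'k::field) set)"
proof -
  let ?q = "mono [a,b,c] - mono [b,a,c] - mono [a,c,b]
     + mono [c,a,b] + mono [b,c,a] - mono [c,b,a] :: _ \<Rightarrow>\<^sub>0 'k"
  have "?q \<in> as2_rels"
    unfolding as2_rels_def mem_Collect_eq
    by (rule exI[of _ "[]"], rule exI[of _ "[a]"], rule exI[of _ "[b]"], rule exI[of _ "[c]"],
        rule exI[of _ "[]"]) simp
  then have "lin_ext scale_pm (\<lambda>w. mono (t, w)) ?q \<in> (hadamard_kernel :: (_ \<Rightarrow>\<^sub>0 'k) set)"
    unfolding hadamard_kernel_def by (intro module.span_base[OF module_scale_pm]) blast
  then show ?thesis by (simp add: lin_ext_simps[OF module_scale_pm])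
qed

lemmas kernel_intros = hadamard_kernel_add hadamard_kernel_diff
  left_symmetric_at_kernel right_commutative_at_kernel second_type_at_kernel

context Der_As2_algebra
begin

lemma novikov1:
  "x \<succ> (y \<prec> z) = (x \<succ> y) \<prec> z"
proof -
  let ?x = "Var 0 :: nat op_term" and ?y = "Var 1 :: nat op_term" and ?z = "Var 2 :: nat op_term"
  let ?X = "Gen 0 :: nat magma" and ?Y = "Gen 1 :: nat magma" and ?Z = "Gen 2 :: nat magma"
  let ?f = "mono (?x \<succ>\<^sub>T (?y \<prec>\<^sub>T ?z)) - mono ((?x \<succ>\<^sub>T ?y) \<prec>\<^sub>T ?z) :: nat op_term \<Rightarrow>\<^sub>0 'k"
  have 1: "multilinear 3 ?f"
    by (intro multilinear_intros) auto
  have "(right_commutative_at ?Y ?Z ?X [0,1,2])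
      \<in> (hadamard_kernel :: (_ \<Rightarrow>\<^sub>0 'k) set)"
    by (intro kernel_intros) simp_all
  then have 2: "lin_ext scale_pm (\<lambda>t. mono (nov_part t, word_part t)) ?f \<in> hadamard_kernel"
    by (simp add: lin_ext_simps[OF module_scale_pm] algebra_simps)
  have "lin_ext scale (eval_term succ prec ((!) [x, y, z])) ?f = 0"
    using 1 2 by (intro white) (auto simp: white_identity_def)
  then show ?thesis
    by (simp add: lin_ext_simps[OF module_axioms] algebra_simps)
qed

lemma novikov2:
  "(x \<prec> y) \<succ> z - x \<succ> (y \<succ> z) = x \<prec> (y \<succ> z) - (x \<prec> y) \<prec> z"
proof -
  let ?x = "Var 0 :: nat op_term" and ?y = "Var 1 :: nat op_term" and ?z = "Var 2 :: nat op_term"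
  let ?X = "Gen 0 :: nat magma" and ?Y = "Gen 1 :: nat magma" and ?Z = "Gen 2 :: nat magma"
  let ?f = "mono ((?x \<prec>\<^sub>T ?y) \<succ>\<^sub>T ?z) - mono (?x \<succ>\<^sub>T (?y \<succ>\<^sub>T ?z)) - mono (?x \<prec>\<^sub>T (?y \<succ>\<^sub>T ?z))
      + mono ((?x \<prec>\<^sub>T ?y) \<prec>\<^sub>T ?z) :: nat op_term \<Rightarrow>\<^sub>0 'k"
  have 1: "multilinear 3 ?f"
    by (intro multilinear_intros) auto
  have "(left_symmetric_at ?X ?Z ?Y [0,1,2]) + (right_commutative_at ?X ?Y ?Z [0,1,2])
      + (right_commutative_at ?Z ?X ?Y [0,1,2])
      \<in> (hadamard_kernel :: (_ \<Rightarrow>\<^sub>0 'k) set)"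
    by (intro kernel_intros) simp_all
  then have 2: "lin_ext scale_pm (\<lambda>t. mono (nov_part t, word_part t)) ?f \<in> hadamard_kernel"
    by (simp add: lin_ext_simps[OF module_scale_pm] algebra_simps)
  have "lin_ext scale (eval_term succ prec ((!) [x, y, z])) ?f = 0"
    using 1 2 by (intro white) (auto simp: white_identity_def)
  then show ?thesis
    by (simp add: lin_ext_simps[OF module_axioms] algebra_simps)
qed

lemma second_type1:
  "(a \<succ> b) \<succ> c - a \<succ> (b \<succ> c) - (a \<succ> c) \<succ> b + a \<succ> (c \<succ> b) - (b \<prec> a) \<succ> c + b \<succ> (a \<succ> c)
      + b \<prec> (c \<prec> a) - (b \<prec> c) \<prec> a + (c \<prec> a) \<succ> b - c \<succ> (a \<succ> b) - c \<prec> (b \<prec> a) + (c \<prec> b) \<prec> a = 0"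
proof -
  let ?x = "Var 0 :: nat op_term" and ?y = "Var 1 :: nat op_term" and ?z = "Var 2 :: nat op_term"
  let ?X = "Gen 0 :: nat magma" and ?Y = "Gen 1 :: nat magma" and ?Z = "Gen 2 :: nat magma"
  let ?f = "mono ((?x \<succ>\<^sub>T ?y) \<succ>\<^sub>T ?z) - mono (?x \<succ>\<^sub>T (?y \<succ>\<^sub>T ?z)) - mono ((?x \<succ>\<^sub>T ?z) \<succ>\<^sub>T ?y)
      + mono (?x \<succ>\<^sub>T (?z \<succ>\<^sub>T ?y)) - mono ((?y \<prec>\<^sub>T ?x) \<succ>\<^sub>T ?z) + mono (?y \<succ>\<^sub>T (?x \<succ>\<^sub>T ?z))
      + mono (?y \<prec>\<^sub>T (?z \<prec>\<^sub>T ?x)) - mono ((?y \<prec>\<^sub>T ?z) \<prec>\<^sub>T ?x) + mono ((?z \<prec>\<^sub>T ?x) \<succ>\<^sub>T ?y)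
      - mono (?z \<succ>\<^sub>T (?x \<succ>\<^sub>T ?y)) - mono (?z \<prec>\<^sub>T (?y \<prec>\<^sub>T ?x)) + mono ((?z \<prec>\<^sub>T ?y) \<prec>\<^sub>T ?x) :: nat op_term \<Rightarrow>\<^sub>0 'k"
  have 1: "multilinear 3 ?f"
    by (intro multilinear_intros) auto
  have "(second_type_at (?Z \<circ>\<^sub>N (?Y \<circ>\<^sub>N ?X)) 0 1 2) - (second_type_at ((?Z \<circ>\<^sub>N ?Y) \<circ>\<^sub>N ?X) 0 1 2)
      + (left_symmetric_at ?Y ?Z ?X [0,2,1]) - (right_commutative_at ?Z ?Y ?X [1,0,2])
      - (left_symmetric_at ?Y ?Z ?X [1,2,0]) - (left_symmetric_at ?Y ?Z ?X [2,0,1])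
      + (right_commutative_at ?Y ?Z ?X [2,0,1])
      \<in> (hadamard_kernel :: (_ \<Rightarrow>\<^sub>0 'k) set)"
    by (intro kernel_intros) simp_all
  then have 2: "lin_ext scale_pm (\<lambda>t. mono (nov_part t, word_part t)) ?f \<in> hadamard_kernel"
    by (simp add: lin_ext_simps[OF module_scale_pm] algebra_simps)
  have "lin_ext scale (eval_term succ prec ((!) [a, b, c])) ?f = 0"
    using 1 2 by (intro white) (auto simp: white_identity_def)
  then show ?thesis
    by (simp add: lin_ext_simps[OF module_axioms] algebra_simps)
qed

lemma second_type2:
  "a \<succ> (b \<succ> c) - (a \<succ> c) \<prec> b - b \<succ> (a \<succ> c) + (b \<succ> c) \<prec> a + (c \<prec> a) \<prec> b - (c \<prec> b) \<prec> a = 0"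
proof -
  let ?x = "Var 0 :: nat op_term" and ?y = "Var 1 :: nat op_term" and ?z = "Var 2 :: nat op_term"
  let ?X = "Gen 0 :: nat magma" and ?Y = "Gen 1 :: nat magma" and ?Z = "Gen 2 :: nat magma"
  let ?f = "mono (?x \<succ>\<^sub>T (?y \<succ>\<^sub>T ?z)) - mono ((?x \<succ>\<^sub>T ?z) \<prec>\<^sub>T ?y) - mono (?y \<succ>\<^sub>T (?x \<succ>\<^sub>T ?z))
      + mono ((?y \<succ>\<^sub>T ?z) \<prec>\<^sub>T ?x) + mono ((?z \<prec>\<^sub>T ?x) \<prec>\<^sub>T ?y) - mono ((?z \<prec>\<^sub>T ?y) \<prec>\<^sub>T ?x) :: nat op_term \<Rightarrow>\<^sub>0 'k"
  have 1: "multilinear 3 ?f"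
    by (intro multilinear_intros) auto
  have "(second_type_at ((?Z \<circ>\<^sub>N ?Y) \<circ>\<^sub>N ?X) 0 1 2) + (right_commutative_at ?Z ?Y ?X [0,2,1])
      + (right_commutative_at ?Z ?Y ?X [1,0,2]) - (right_commutative_at ?Z ?Y ?X [2,0,1])
      \<in> (hadamard_kernel :: (_ \<Rightarrow>\<^sub>0 'k) set)"
    by (intro kernel_intros) simp_all
  then have 2: "lin_ext scale_pm (\<lambda>t. mono (nov_part t, word_part t)) ?f \<in> hadamard_kernel"
    by (simp add: lin_ext_simps[OF module_scale_pm] algebra_simps)
  have "lin_ext scale (eval_term succ prec ((!) [a, b, c])) ?f = 0"
    using 1 2 by (intro white) (auto simp: white_identity_def)
  then show ?thesis
    by (simp add: lin_ext_simps[OF module_axioms] algebra_simps)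
qed

end

end

theory Submission
  imports Defs "HOL-Library.Multiset" "HOL-Library.Function_Algebras"
begin

text \<open>
  Words in formal derivatives \<open>(x, k)\<close>, read as \<open>d\<^sup>k(x)\<close>, span the free associative differential
  algebra. Give a letter \<open>(x, k)\<close> the weight \<open>k - 1\<close>, so that generators have weight \<open>-1\<close> and \<open>d\<close>
  raises the weight by one. The products \<open>d(a) b\<close> and \<open>a d(b)\<close> of elements of weight \<open>-1\<close> again
  have weight \<open>-1\<close>. The proof rests on the converse: every word of weight \<open>-1\<close> is a combination of
  values of terms in these two operations (\<open>homogeneous_in_span_expand\<close>). It holds in any
  differential associative ring, with letters from any additive subgroup closed under the two
  operations (\<open>word_value_mem\<close>).

  Hence every word of weight \<open>-1\<close> should act on a \<open>Der As2\<close>-algebra \<open>V\<close>: write it as a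
  combination of terms and evaluate the terms in \<open>V\<close>. The result, extended linearly, is the map \<open>ev\<close>.
  For it to be well defined, a multilinear combination of terms that vanishes in the free
  second-type differential algebra must be a white identity. This needs the embedding of the free
  Novikov algebra into differential polynomials, a theorem of Dzhumadil'daev and Loefwall: the
  Novikov part of a term depends only on the commutative differential polynomial that the term
  expands to. The section on Novikov algebras proves it by constructing, in any Novikov algebra, the
  value of each commutative differential monomial of weight \<open>-1\<close> (\<open>monomial_mset\<close>,
  \<open>star_monomial\<close>). The consequence needed is \<open>vanishing_expansion_in_kernel\<close>.

  The enveloping algebra is then a quotient of the free differential algebra without unit. The
  ideal consists of all \<open>p\<close> such that \<open>ev\<close> vanishes on \<open>l d\<^sup>k(p) r\<close> for all \<open>l\<close>, \<open>r\<close>, \<open>k\<close>. It contains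
  the values of the second-type identity because \<open>ev\<close> satisfies this identity (\<open>ev_as2_rels\<close>). It
  contains \<open>p - q\<close> whenever \<open>p\<close> and \<open>q\<close> have weight \<open>-1\<close> and the same value \<open>ev p = ev q\<close>
  (\<open>ev_replace_letter\<close>); this makes \<open>V\<close> a subalgebra for the two derived operations. Taking
  \<open>l = r = 1\<close> and \<open>k = 0\<close> shows that a nonzero element of \<open>V\<close> does not lie in the ideal.
\<close>

section \<open>Lists with one entry changed\<close>

text \<open>
  Applying a derivation to a product changes one factor at a time. The entries of
  \<open>replace_each h xs\<close> are the terms of the resulting sum.
\<close>

primrec replace_each :: "('a \<Rightarrow> 'a) \<Rightarrow> 'a list \<Rightarrow> 'a list list" where
  "replace_each h [] = []"
| "replace_each h (x # xs) = (h x # xs) # map ((#) x) (replace_each h xs)"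

lemma replace_each_append:
  "replace_each h (xs @ ys) =
     map (\<lambda>l. l @ ys) (replace_each h xs) @ map ((@) xs) (replace_each h ys)"
  by (induction xs) (auto simp: comp_def)

lemma length_replace_each: "l \<in> set (replace_each h xs) \<Longrightarrow> length l = length xs"
  by (induction xs arbitrary: l) auto

lemma in_set_replace_each:
  "l \<in> set (replace_each h xs) \<Longrightarrow> \<exists>us x vs. xs = us @ x # vs \<and> l = us @ h x # vs"
  by (induction xs arbitrary: l) (auto, blast, metis append_Cons)

lemma replace_each_map:
  assumes "\<And>x. h (g x) = g (h' x)"
  shows "replace_each h (map g xs) = map (map g) (replace_each h' xs)"
  using assms by (induction xs) (auto simp: comp_def)

text \<open>
  Adjacent transpositions generate all permutations.
\<close>

lemma symmetric_from_adjacent: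
  assumes swap: "\<And>xs a b ys. f (xs @ a # b # ys) = f (xs @ b # a # ys)"
    and "mset us = mset vs"
  shows "f us = f vs"
proof -
  have move: "f (ps @ xs @ a # ys) = f (ps @ a # xs @ ys)" for ps xs a ys
  proof (induction xs arbitrary: ps)
    case (Cons x xs)
    have "f (ps @ (x # xs) @ a # ys) = f (ps @ x # a # xs @ ys)"
      using Cons[of "ps @ [x]"] by simp
    also have "\<dots> = f (ps @ a # x # xs @ ys)" by (rule swap)
    finally show ?case by simp
  qed simp
  have "mset us = mset vs \<Longrightarrow> f (ps @ us) = f (ps @ vs)" for ps
  proof (induction us arbitrary: ps vs)
    case (Cons u us)
    then have "u \<in> set vs" by (metis list.set_intros(1) set_mset_mset)
    then obtain xs ys where vs: "vs = xs @ u # ys" by (auto dest: split_list)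
    with Cons.prems have "mset us = mset (xs @ ys)" by simp
    then have "f ((ps @ [u]) @ us) = f ((ps @ [u]) @ xs @ ys)" by (rule Cons.IH)
    also have "\<dots> = f (ps @ vs)" using move[of ps xs u ys] by (simp add: vs)
    finally show ?case by simp
  qed simp
  from this[of "[]"] show ?thesis using assms(2) by simp
qed

lemma sum_list_replace_each_symmetric:
  fixes f :: "'a list \<Rightarrow> 'b::comm_monoid_add"
  assumes f: "\<And>us vs. mset us = mset vs \<Longrightarrow> f us = f vs"
    and "mset us = mset vs"
  shows "(\<Sum>l\<leftarrow>replace_each h us. f l) = (\<Sum>l\<leftarrow>replace_each h vs. f l)"
proof (rule symmetric_from_adjacent[where f = "\<lambda>us. \<Sum>l\<leftarrow>replace_each h us. f l", OF _ assms(2)])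
  fix xs ys a b
  have "(\<Sum>l\<leftarrow>replace_each h xs. f (l @ a # b # ys)) = (\<Sum>l\<leftarrow>replace_each h xs. f (l @ b # a # ys))"
    "(\<Sum>l\<leftarrow>replace_each h ys. f (xs @ a # b # l)) = (\<Sum>l\<leftarrow>replace_each h ys. f (xs @ b # a # l))"
    "f (xs @ h a # b # ys) = f (xs @ b # h a # ys)" "f (xs @ a # h b # ys) = f (xs @ h b # a # ys)"
    by (auto intro!: arg_cong[where f = sum_list] f)
  then show "(\<Sum>l\<leftarrow>replace_each h (xs @ a # b # ys). f l)
      = (\<Sum>l\<leftarrow>replace_each h (xs @ b # a # ys). f l)"
    by (simp add: replace_each_append comp_def ac_simps)
qed

section \<open>Weights of differential words\<close>

abbreviation raise :: "'x \<times> nat \<Rightarrow> 'x \<times> nat" where "raise \<equiv> apsnd Suc"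

definition weight :: "('x \<times> nat) list \<Rightarrow> int" where
  "weight w = (\<Sum>p\<leftarrow>w. int (snd p) - 1)"

lemma weight_simps [simp]:
  "weight [] = 0" "weight (p # w) = int (snd p) - 1 + weight w" "weight (v @ w) = weight v + weight w"
  by (simp_all add: weight_def)

lemma weight_mset: "mset v = mset w \<Longrightarrow> weight v = weight w"
  unfolding weight_def by (metis mset_map sum_mset_sum_list)

lemma weight_replace_each_raise: "l \<in> set (replace_each raise w) \<Longrightarrow> weight l = weight w + 1"
  by (induction w arbitrary: l) auto

section \<open>Values of differential monomials in a Novikov algebra\<close>

text \<open>
  The model is a commutative differential algebra with \<open>u \<star> v = u d(v)\<close>. A Novikov algebra has
  neither the commutative product nor the derivation, but all monomials of weight \<open>-1\<close> make sense
  in it, as is shown in this section.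
\<close>

locale novikov =
  fixes nov :: "'n::ab_group_add \<Rightarrow> 'n \<Rightarrow> 'n"  (infixl \<open>\<star>\<close> 70)
  assumes add_left: "(a + b) \<star> c = a \<star> c + b \<star> c"
    and add_right: "a \<star> (b + c) = a \<star> b + a \<star> c"
    and left_symmetric: "(u \<star> v) \<star> w - u \<star> (v \<star> w) = (v \<star> u) \<star> w - v \<star> (u \<star> w)"
    and right_commutative: "(u \<star> v) \<star> w = (u \<star> w) \<star> v"
begin

lemma zero_right: "c \<star> 0 = 0"
  using add_right[of c 0 0] by simp

lemma diff_right: "c \<star> (a - b) = c \<star> a - c \<star> b"
  using add_right[of c "a - b" b] by (simp add: algebra_simps)

lemma sum_list_right: "c \<star> (\<Sum>l\<leftarrow>ls. f l) = (\<Sum>l\<leftarrow>ls. c \<star> f l)"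
  by (induction ls) (auto simp: zero_right add_right)

text \<open>
  In the model, \<open>brace [u1, ..., uk] x\<close> is \<open>u1 ... uk d\<^sup>k(x)\<close>: the sum subtracted is what the
  derivation in \<open>u d(us d\<^sup>k(x))\<close> contributes on the factors \<open>us\<close>. These are the symmetric brace
  operations of a pre-Lie algebra.
\<close>

function brace :: "'n list \<Rightarrow> 'n \<Rightarrow> 'n" where
  "brace [] x = x"
| "brace (u # us) x = u \<star> brace us x - (\<Sum>l\<leftarrow>replace_each ((\<star>) u) us. brace l x)"
  by pat_completeness auto
termination
  by (relation "measure (\<lambda>(us, x). length us)") (auto dest: length_replace_each)

lemma brace_add: "brace (xs @ (a + b) # ys) x = brace (xs @ a # ys) x + brace (xs @ b # ys) x"
proof (induction "length (xs @ ys)" arbitrary: xs ys a b)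
  case 0
  then show ?case by (simp add: add_left)
next
  case (Suc n)
  show ?case
  proof (cases xs)
    case Nil
    have "(\<Sum>l\<leftarrow>replace_each ((\<star>) (a + b)) ys. brace (zs @ l) x)
        = (\<Sum>l\<leftarrow>replace_each ((\<star>) a) ys. brace (zs @ l) x)
        + (\<Sum>l\<leftarrow>replace_each ((\<star>) b) ys. brace (zs @ l) x)" if "length (zs @ ys) = Suc n" for zs
      using that
    proof (induction ys arbitrary: zs)
      case (Cons y ys)
      then show ?case
        using Cons.IH[of "zs @ [y]"] Suc.hyps(1)[of zs ys "a \<star> y" "b \<star> y"]
        by (simp add: comp_def add_left)
    qed simp
    from this[of "[]"] Suc.hyps(2) show ?thesis by (simp add: Nil add_left)
  next
    case (Cons u us)
    have IH: "brace (l @ (a + b) # m) x = brace (l @ a # m) x + brace (l @ b # m) x"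
      if "length l = length us" "length m = length ys" for l m a b
      using Suc.hyps(1)[of l m a b] Suc.hyps(2) that by (simp add: Cons)
    have 1: "(\<Sum>l\<leftarrow>replace_each ((\<star>) u) us. brace (l @ (a + b) # ys) x)
       = (\<Sum>l\<leftarrow>replace_each ((\<star>) u) us. brace (l @ a # ys) x)
       + (\<Sum>l\<leftarrow>replace_each ((\<star>) u) us. brace (l @ b # ys) x)"
      by (subst sum_list_addf[symmetric])
        (auto intro!: arg_cong[where f = sum_list] IH dest: length_replace_each)
    have 2: "(\<Sum>l\<leftarrow>replace_each ((\<star>) u) ys. brace (us @ (a + b) # l) x)
       = (\<Sum>l\<leftarrow>replace_each ((\<star>) u) ys. brace (us @ a # l) x)
       + (\<Sum>l\<leftarrow>replace_each ((\<star>) u) ys. brace (us @ b # l) x)"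
      by (subst sum_list_addf[symmetric])
        (auto intro!: arg_cong[where f = sum_list] IH dest: length_replace_each)
    show ?thesis
      by (simp add: Cons replace_each_append comp_def 1 2 IH add_right)
  qed
qed

text \<open>
  Let \<open>u d\<close> and then \<open>v d\<close> act on a product by the Leibniz rule, and add the action of \<open>(u d(v)) d\<close>.
  The result is symmetric in \<open>u\<close> and \<open>v\<close>: where one entry is hit twice this is left symmetry, and two
  different entries can be hit in either order.
\<close>

lemma second_derivative_symmetric:
  fixes f :: "'n list \<Rightarrow> 'n"
  assumes "\<And>xs a b ys. f (xs @ (a + b) # ys) = f (xs @ a # ys) + f (xs @ b # ys)"
  shows "(\<Sum>l\<leftarrow>replace_each ((\<star>) (u \<star> v)) us. f l)
        + (\<Sum>l\<leftarrow>replace_each ((\<star>) u) us. \<Sum>m\<leftarrow>replace_each ((\<star>) v) l. f m)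
      = (\<Sum>l\<leftarrow>replace_each ((\<star>) (v \<star> u)) us. f l)
        + (\<Sum>l\<leftarrow>replace_each ((\<star>) v) us. \<Sum>m\<leftarrow>replace_each ((\<star>) u) l. f m)"
  using assms
proof (induction us arbitrary: f)
  case (Cons w ws)
  have "f (((u \<star> v) \<star> w) # ws) + f ((v \<star> (u \<star> w)) # ws)
      = f (((v \<star> u) \<star> w) # ws) + f ((u \<star> (v \<star> w)) # ws)"
  proof -
    have "(u \<star> v) \<star> w + v \<star> (u \<star> w) = (v \<star> u) \<star> w + u \<star> (v \<star> w)"
      using left_symmetric[of u v w] by (simp add: algebra_simps)
    then show ?thesis using Cons.prems[of "[]" _ _ ws] by (metis append_Nil)
  qed
  moreover have "(\<Sum>l\<leftarrow>replace_each ((\<star>) (u \<star> v)) ws. f (w # l))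
        + (\<Sum>l\<leftarrow>replace_each ((\<star>) u) ws. \<Sum>m\<leftarrow>replace_each ((\<star>) v) l. f (w # m))
      = (\<Sum>l\<leftarrow>replace_each ((\<star>) (v \<star> u)) ws. f (w # l))
        + (\<Sum>l\<leftarrow>replace_each ((\<star>) v) ws. \<Sum>m\<leftarrow>replace_each ((\<star>) u) l. f (w # m))"
    by (rule Cons.IH) (metis Cons.prems append_Cons)
  ultimately show ?case
    by (simp add: comp_def sum_list_addf algebra_simps)
qed simp

lemma brace_swap_front: "brace (u # v # us) x = brace (v # u # us) x"
proof -
  have *: "brace (u # v # us) x = (u \<star> (v \<star> brace us x) - (u \<star> v) \<star> brace us x)
      - ((\<Sum>l\<leftarrow>replace_each ((\<star>) v) us. u \<star> brace l x)
         + (\<Sum>l\<leftarrow>replace_each ((\<star>) u) us. v \<star> brace l x))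
      + ((\<Sum>l\<leftarrow>replace_each ((\<star>) (u \<star> v)) us. brace l x)
         + (\<Sum>l\<leftarrow>replace_each ((\<star>) u) us. \<Sum>m\<leftarrow>replace_each ((\<star>) v) l. brace m x))" for u v
    by (simp add: comp_def diff_right sum_list_right sum_list_subtractf algebra_simps)
  show ?thesis
    unfolding * second_derivative_symmetric[of "\<lambda>l. brace l x" u v us, OF brace_add]
    using left_symmetric[of u v "brace us x"] by (simp add: algebra_simps)
qed

lemma brace_swap: "brace (xs @ a # b # ys) x = brace (xs @ b # a # ys) x"
proof (induction "length xs + length ys" arbitrary: xs ys a b rule: less_induct)
  case less
  show ?case
  proof (cases xs)
    case (Cons u us)
    have IH: "brace (l @ a # b # m) x = brace (l @ b # a # m) x"
      if "length l = length us" "length m = length ys" for l m a b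
      using less[of l m a b] that by (simp add: Cons)
    have 1: "(\<Sum>l\<leftarrow>replace_each ((\<star>) u) us. brace (l @ a # b # ys) x)
       = (\<Sum>l\<leftarrow>replace_each ((\<star>) u) us. brace (l @ b # a # ys) x)"
      by (auto intro!: arg_cong[where f = sum_list] IH dest: length_replace_each)
    have 2: "(\<Sum>l\<leftarrow>replace_each ((\<star>) u) ys. brace (us @ a # b # l) x)
       = (\<Sum>l\<leftarrow>replace_each ((\<star>) u) ys. brace (us @ b # a # l) x)"
      by (auto intro!: arg_cong[where f = sum_list] IH dest: length_replace_each)
    show ?thesis
      by (simp add: Cons replace_each_append comp_def 1 2 IH[of us ys] algebra_simps)
  qed (simp only: brace_swap_front append_Nil)
qed

lemma brace_mset: "mset us = mset vs \<Longrightarrow> brace us x = brace vs x"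
  by (rule symmetric_from_adjacent[where f = "\<lambda>us. brace us x"]) (rule brace_swap)

text \<open>
  By recursion, \<open>a \<mapsto> brace (a # us) x\<close> is a polynomial in the operators \<open>a \<mapsto> a \<star> y\<close> of right
  multiplication. So it commutes with every additive map that commutes with these.
\<close>

lemma brace_commutes:
  assumes add: "\<And>a b. c (a + b) = c a + c b" and R: "\<And>a y. c (a \<star> y) = c a \<star> y"
  shows "brace (c a # us) x = c (brace (a # us) x)"
proof -
  have zero: "c 0 = 0" using add[of 0 0] by simp
  have diff: "c (a - b) = c a - c b" for a b using add[of "a - b" b] by (simp add: algebra_simps)
  show ?thesis
  proof (induction "length us" arbitrary: us a rule: less_induct)
    case less
    have IH: "brace (xs @ c b # ys) x = c (brace (xs @ b # ys) x)"
      if "length us = Suc (length (xs @ ys))" for xs b ys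
    proof -
      have "brace (xs @ c b # ys) x = brace (c b # xs @ ys) x" by (rule brace_mset) simp
      also have "\<dots> = c (brace (b # xs @ ys) x)" using that by (intro less) simp
      also have "brace (b # xs @ ys) x = brace (xs @ b # ys) x" by (rule brace_mset) simp
      finally show ?thesis .
    qed
    have "(\<Sum>l\<leftarrow>replace_each ((\<star>) (c a)) ys. brace (xs @ l) x)
        = c (\<Sum>l\<leftarrow>replace_each ((\<star>) a) ys. brace (xs @ l) x)"
      if "length us = length (xs @ ys)" for xs ys
      using that
    proof (induction ys arbitrary: xs)
      case (Cons y ys)
      then show ?case
        using Cons.IH[of "xs @ [y]"] IH[of xs ys "a \<star> y"] by (simp add: comp_def add R)
    qed (simp add: zero)
    from this[of "[]"] show ?case by (simp add: diff R)
  qed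
qed

text \<open>
  Right multiplications commute with each other by right commutativity, hence so do the
  polynomials in them. In the model both sides are \<open>a us d\<^sup>k(x) vs d\<^sup>l(y)\<close>.
\<close>

lemma brace_brace:
  "brace (brace (a # us) x # vs) y = brace (brace (a # vs) y # us) x"
proof (rule brace_commutes[where c = "\<lambda>a. brace (a # us) x"])
  show "brace ((a + b) # us) x = brace (a # us) x + brace (b # us) x" for a b
    using brace_add[of "[]"] by simp
  show "brace (a \<star> y # us) x = brace (a # us) x \<star> y" for a y
    by (rule brace_commutes[where c = "\<lambda>a. a \<star> y"]) (simp_all add: add_left right_commutative)
qed

text \<open>
  A differential monomial of weight \<open>-1\<close> is given by its underived factors \<open>zs\<close> and its derived
  factors \<open>ps\<close>. It is evaluated greedily: a factor \<open>d\<^sup>k(x)\<close> absorbs the first \<open>k\<close> underived factors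
  and forms a new underived factor with them.
\<close>

fun collapse :: "'n list \<Rightarrow> ('n \<times> nat) list \<Rightarrow> 'n" where
  "collapse zs [] = hd zs"
| "collapse zs ((x, k) # ps) = collapse (brace (take k zs) x # drop k zs) ps"

text \<open>
  Weight \<open>-1\<close> in terms of the two lists. Since every derived factor has order at least one, this
  ensures that enough underived factors are left at each step and exactly one at the end.
\<close>

definition balanced :: "'n list \<Rightarrow> ('n \<times> nat) list \<Rightarrow> bool" where
  "balanced zs ps \<longleftrightarrow> (\<forall>p\<in>set ps. 0 < snd p) \<and> length zs + length ps = Suc (\<Sum>p\<leftarrow>ps. snd p)"

lemma sum_list_ge_length: "(\<forall>p\<in>set ps. 0 < snd p) \<Longrightarrow> length ps \<le> (\<Sum>p\<leftarrow>ps. snd p :: nat)"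
  by (induction ps) auto

lemma balanced_Cons:
  assumes "balanced zs ((x, k) # ps)"
  obtains z us vs where "zs = z # us @ vs" "k = Suc (length us)"
    "\<And>a. balanced (a # vs) ps"
proof -
  from assms have k: "0 < k" and ps: "\<forall>p\<in>set ps. 0 < snd p"
    and len: "length zs + length ps = k + (\<Sum>p\<leftarrow>ps. snd p)"
    by (auto simp: balanced_def)
  from sum_list_ge_length[OF ps] len have "k \<le> length zs" by simp
  with k obtain z zs' where zs: "zs = z # zs'" by (cases zs) auto
  show ?thesis
  proof
    show "zs = z # take (k - 1) zs' @ drop (k - 1) zs'" by (simp add: zs)
    show "k = Suc (length (take (k - 1) zs'))" using \<open>k \<le> length zs\<close> k by (simp add: zs)
    show "balanced (a # drop (k - 1) zs') ps" for a
      using ps len k \<open>k \<le> length zs\<close> by (auto simp: balanced_def zs)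
  qed
qed

text \<open>
  Every later step applies an operator of the form \<open>a \<mapsto> brace (a # ws) y\<close> to the first factor,
  and these operators commute.
\<close>

lemma collapse_brace:
  "balanced (a # vs) ps \<Longrightarrow> collapse (brace (a # us) x # vs) ps = brace (collapse (a # vs) ps # us) x"
proof (induction ps arbitrary: a vs)
  case (Cons p ps)
  obtain y k where p: "p = (y, k)" by force
  from Cons.prems obtain ws vs' where vs: "vs = ws @ vs'" "k = Suc (length ws)"
    and bal: "\<And>b. balanced (b # vs') ps"
    unfolding p by (rule balanced_Cons) auto
  show ?case
    using Cons.IH[OF bal, of "brace (a # ws) y"]
      by (simp add: p vs brace_brace[of a us] del: brace.simps)
qed simp

lemma balanced_mset: "mset zs = mset zs' \<Longrightarrow> balanced zs ps \<Longrightarrow> balanced zs' ps"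
  by (metis balanced_def size_mset)

text \<open>
  Consider two adjacent factors. If the first derived factor absorbs both, \<open>brace\<close> is symmetric; if
  it absorbs only one, \<open>collapse_brace\<close> pulls the absorbing operator out of the rest, which is
  symmetric by induction.
\<close>

lemma collapse_mset_left:
  "balanced zs ps \<Longrightarrow> mset zs = mset zs' \<Longrightarrow> collapse zs ps = collapse zs' ps"
proof (induction ps arbitrary: zs zs')
  case Nil
  then obtain z where "zs = [z]" by (cases zs) (auto simp: balanced_def)
  with Nil show ?case by simp
next
  case (Cons p ps)
  obtain x k where p: "p = (x, k)" by force
  have adj: "collapse (xs @ a # b # ys) (p # ps) = collapse (xs @ b # a # ys) (p # ps)"
    if bal: "balanced (xs @ a # b # ys) (p # ps)" for xs a b ys
  proof -
    \<comment> \<open>The first derived factor absorbs neither of the two entries, only the first of them, or both.\<close>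
    consider "k \<le> length xs" | "k = Suc (length xs)" | "Suc (Suc (length xs)) \<le> k" by linarith
    then show ?thesis
    proof cases
      case 1
      from bal obtain z us vs where *: "xs @ a # b # ys = z # us @ vs" "k = Suc (length us)"
        "\<And>c. balanced (c # vs) ps"
        unfolding p by (rule balanced_Cons) blast
      from *(1,2) have vs: "vs = drop k xs @ a # b # ys"
        using 1 by (metis append_Cons append_eq_conv_conj diff_is_0_eq' drop0 drop_append length_Cons)
      have "collapse (c # vs) ps = collapse (c # drop k xs @ b # a # ys) ps" for c
        by (rule Cons.IH[OF *(3)]) (simp add: vs)
      then show ?thesis using 1 by (simp add: p vs)
    next
      case 2
      from bal obtain z us vs where *: "xs @ a # b # ys = z # us @ vs" "k = Suc (length us)"
        "\<And>c. balanced (c # vs) ps"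
        unfolding p by (rule balanced_Cons) blast
      from *(1,2) 2 have vs: "vs = b # ys"
        by (metis append_Cons append_eq_append_conv append_self_conv2 length_Cons list.inject
            length_append_singleton append.assoc append_Nil)
      have br: "brace (xs @ [c]) x = brace (c # xs) x" for c by (rule brace_mset) simp
      have "collapse (brace (a # xs) x # b # ys) ps = brace (collapse (a # b # ys) ps # xs) x"
        using *(3) by (intro collapse_brace) (simp add: vs)
      also have "collapse (a # b # ys) ps = collapse (b # a # ys) ps"
        using *(3) by (intro Cons.IH) (auto simp: vs)
      also have "brace (collapse (b # a # ys) ps # xs) x = collapse (brace (b # xs) x # a # ys) ps"
        using *(3)[of b] by (intro collapse_brace[symmetric]) (simp add: vs balanced_def)
      finally show ?thesis using 2 by (simp add: p br)
    next
      case 3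
      define m where "m = k - Suc (Suc (length xs))"
      have k: "k = length xs + Suc (Suc m)" using 3 by (simp add: m_def)
      have "brace (xs @ a # b # take m ys) x = brace (xs @ b # a # take m ys) x"
        by (rule brace_swap)
      then show ?thesis by (simp add: p k)
    qed
  qed
  \<comment> \<open>The value may depend on the order of the factors when the lists are not balanced.\<close>
  define f where "f us = (if balanced us (p # ps) then collapse us (p # ps) else 0)" for us
  have "f zs = f zs'"
  proof (rule symmetric_from_adjacent[OF _ Cons.prems(2)])
    show "f (xs @ a # b # ys) = f (xs @ b # a # ys)" for xs a b ys
    proof -
      have "balanced (xs @ a # b # ys) (p # ps) \<longleftrightarrow> balanced (xs @ b # a # ys) (p # ps)"
        unfolding balanced_def by (simp only: length_append length_Cons)
      then show ?thesis using adj[of xs a b ys] unfolding f_def by presburger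
    qed
  qed
  with Cons.prems balanced_mset[OF Cons.prems(2,1)] show ?case by (simp add: f_def)
qed

lemma collapse_swap_front:
  assumes "balanced zs (p # q # ps)"
  shows "collapse zs (p # q # ps) = collapse zs (q # p # ps)"
proof -
  obtain x k y l where pq: "p = (x, k)" "q = (y, l)" by force
  from assms obtain z us zs' where 1: "zs = z # us @ zs'" "k = Suc (length us)"
    "balanced (brace (z # us) x # zs') (q # ps)"
    unfolding pq by (rule balanced_Cons) auto
  from 1(3) obtain vs ws where 2: "zs' = vs @ ws" "l = Suc (length vs)"
    unfolding pq by (rule balanced_Cons) auto
  have "collapse zs (q # p # ps) = collapse (z # vs @ us @ ws) (q # p # ps)"
    using assms by (intro collapse_mset_left) (auto simp: 1 2 balanced_def)
  then show ?thesis using brace_brace[of z us x vs y] by (simp add: pq 1(1,2) 2)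
qed

text \<open>
  Two consecutive derived factors can be interchanged: after a permutation of the underived
  factors they act on the same entry by commuting operators.
\<close>

lemma collapse_mset_right:
  assumes "balanced zs ps" "mset ps = mset qs"
  shows "collapse zs ps = collapse zs qs"
proof -
  have adj: "balanced zs (xs @ p # q # ys) \<Longrightarrow>
      collapse zs (xs @ p # q # ys) = collapse zs (xs @ q # p # ys)" for xs p q ys zs
  proof (induction xs arbitrary: zs)
    case Nil
    then show ?case using collapse_swap_front[of zs p q ys] by simp
  next
    case (Cons r xs)
    obtain x k where r: "r = (x, k)" by force
    from Cons.prems obtain z us vs where "zs = z # us @ vs" "k = Suc (length us)"
      "\<And>a. balanced (a # vs) (xs @ p # q # ys)"
      unfolding r append_Cons by (rule balanced_Cons) blast
    then show ?case using Cons.IH by (simp add: r)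
  qed
  define f where "f us = (if balanced zs us then collapse zs us else 0)" for us
  have "f ps = f qs"
  proof (rule symmetric_from_adjacent[OF _ assms(2)])
    show "f (xs @ a # b # ys) = f (xs @ b # a # ys)" for xs a b ys
    proof -
      have "balanced zs (xs @ a # b # ys) \<longleftrightarrow> balanced zs (xs @ b # a # ys)"
        unfolding balanced_def by (auto simp only: length_append length_Cons set_append
            list.set map_append list.map sum_list.append sum_list.Cons ac_simps)
      then show ?thesis using adj[of zs xs a b ys] unfolding f_def by presburger
    qed
  qed
  moreover have "balanced zs qs"
    using assms by (metis balanced_def mset_map set_mset_mset size_mset sum_mset_sum_list)
  ultimately show ?thesis using assms(1) by (simp add: f_def)
qed

text \<open>
  A submonomial of weight \<open>-1\<close> can be replaced by its value.
\<close>

lemma collapse_append: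
  "balanced zs ps \<Longrightarrow> collapse (zs @ zs') (ps @ ps') = collapse (collapse zs ps # zs') ps'"
proof (induction ps arbitrary: zs)
  case Nil
  then obtain z where "zs = [z]" by (cases zs) (auto simp: balanced_def)
  then show ?case by simp
next
  case (Cons p ps)
  obtain x k where p: "p = (x, k)" by force
  from Cons.prems obtain z us vs where "zs = z # us @ vs" "k = Suc (length us)"
    "\<And>a. balanced (a # vs) ps"
    unfolding p by (rule balanced_Cons) blast
  then show ?case using Cons.IH[of "brace (z # us) x # vs"] by (simp add: p del: brace.simps)
qed

text \<open>
  The Leibniz rule for \<open>u d(zs ps)\<close>. By the recursion of \<open>brace\<close>, a derived factor together with
  what it absorbs contributes exactly the terms in which one of these is differentiated.
\<close>

lemma star_collapse:
  "balanced zs ps \<Longrightarrow> u \<star> collapse zs ps =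
     (\<Sum>l\<leftarrow>replace_each ((\<star>) u) zs. collapse l ps)
     + (\<Sum>q\<leftarrow>replace_each raise ps. collapse (u # zs) q)"
proof (induction ps arbitrary: zs)
  case Nil
  then obtain z where "zs = [z]" by (cases zs) (auto simp: balanced_def)
  then show ?case by simp
next
  case (Cons p ps)
  obtain x k where p: "p = (x, k)" by force
  from Cons.prems obtain z us vs where zs: "zs = z # us @ vs" and k: "k = Suc (length us)"
    and bal: "\<And>a. balanced (a # vs) ps"
    unfolding p by (rule balanced_Cons) blast
  let ?zu = "z # us"
  \<comment> \<open>additivity in the first entry, needed to distribute over the recursion of the first brace\<close>
  have add: "collapse ((a + b) # vs) ps = collapse (a # vs) ps + collapse (b # vs) ps" for a b
    using bal
  proof (induction ps arbitrary: a b vs)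
    case (Cons q ps)
    obtain y l where q: "q = (y, l)" by force
    from Cons.prems[of a] obtain z' us' vs' where *: "a # vs = z' # us' @ vs'" "l = Suc (length us')"
      "\<And>a. balanced (a # vs') ps"
      unfolding q by (rule balanced_Cons) blast
    then show ?case
      using Cons.IH[OF *(3)] brace_add[of "[]" a b us' y] by (simp add: q)
  qed simp
  have zero: "collapse (0 # vs) ps = 0" using add[of 0 0] by simp
  have sum: "collapse ((\<Sum>l\<leftarrow>ls. f l) # vs) ps = (\<Sum>l\<leftarrow>ls. collapse (f l # vs) ps)" for f and ls :: "'n list list"
    by (induction ls) (auto simp: zero add)
  have "u \<star> brace ?zu x = brace (u # ?zu) x + (\<Sum>l\<leftarrow>replace_each ((\<star>) u) ?zu. brace l x)"
    by (simp only: brace.simps(2)[of u ?zu]) simp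
  then have "collapse (u \<star> brace ?zu x # vs) ps = collapse (brace (u # ?zu) x # vs) ps
      + (\<Sum>l\<leftarrow>replace_each ((\<star>) u) ?zu. collapse (brace l x # vs) ps)"
    by (simp only: add sum)
  moreover have "(\<Sum>l\<leftarrow>replace_each ((\<star>) u) ?zu. collapse (brace l x # vs) ps)
      = (\<Sum>l\<leftarrow>replace_each ((\<star>) u) ?zu. collapse (l @ vs) (p # ps))"
    by (intro arg_cong[where f = sum_list] map_cong) (auto simp: p k dest: length_replace_each)
  moreover have "(\<Sum>l\<leftarrow>replace_each ((\<star>) u) vs. collapse (brace ?zu x # l) ps)
      = (\<Sum>l\<leftarrow>replace_each ((\<star>) u) vs. collapse (?zu @ l) (p # ps))"
    by (simp add: p k)
  moreover have "(\<Sum>q\<leftarrow>replace_each raise ps. collapse (u # brace ?zu x # vs) q)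
      = (\<Sum>q\<leftarrow>replace_each raise ps. collapse (u # zs) (p # q))"
  proof (intro arg_cong[where f = sum_list] map_cong refl)
    fix q assume q: "q \<in> set (replace_each raise ps)"
    have pos: "(\<forall>p\<in>set q. 0 < snd p) \<and> (\<Sum>p\<leftarrow>q. snd p) = Suc (\<Sum>p\<leftarrow>ps. snd p)"
      if "q \<in> set (replace_each raise ps)" "\<forall>p\<in>set ps. 0 < snd p" for q and ps :: "('n \<times> nat) list"
      using that by (induction ps arbitrary: q) (simp, fastforce)
    have bq: "balanced (u # a # vs) q" for a
      using pos[OF q] bal[of a] length_replace_each[OF q] by (auto simp: balanced_def)
    then have bq': "balanced (u # zs) (p # q)"
      using Cons.prems by (auto simp: balanced_def zs p k)
    have "collapse (u # zs) (p # q) = collapse (zs @ [u]) (p # q)"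
      using bq' by (intro collapse_mset_left) auto
    also have "\<dots> = collapse (brace ?zu x # vs @ [u]) q" by (simp add: zs p k)
    also have "\<dots> = collapse (u # brace ?zu x # vs) q"
      using bq by (intro collapse_mset_left) (auto simp: balanced_def)
    finally show "collapse (u # brace ?zu x # vs) q = collapse (u # zs) (p # q)" by simp
  qed
  moreover have "collapse (brace (u # ?zu) x # vs) ps = collapse (u # zs) (raise p # ps)"
    by (simp add: p k zs)
  moreover have "u \<star> collapse zs (p # ps) = u \<star> collapse (brace ?zu x # vs) ps"
    by (simp add: zs p k)
  moreover have "replace_each ((\<star>) u) zs
     = map (\<lambda>l. l @ vs) (replace_each ((\<star>) u) ?zu) @ map ((@) ?zu) (replace_each ((\<star>) u) vs)"
    using replace_each_append[of "(\<star>) u" ?zu vs] by (simp only: zs append_Cons)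
  ultimately show ?case
    using Cons.IH[OF bal[of "brace ?zu x"]]
    by (simp add: comp_def add.assoc add.left_commute)
qed

abbreviation zeros :: "('n \<times> nat) list \<Rightarrow> 'n list" where
  "zeros w \<equiv> map fst (filter (\<lambda>p. snd p = 0) w)"

abbreviation positives :: "('n \<times> nat) list \<Rightarrow> ('n \<times> nat) list" where
  "positives w \<equiv> filter (\<lambda>p. 0 < snd p) w"

text \<open>
  The default value outside weight \<open>-1\<close> keeps the function invariant under permutations.
\<close>

definition monomial :: "('n \<times> nat) list \<Rightarrow> 'n" where
  "monomial w = (if weight w = -1 then collapse (zeros w) (positives w) else 0)"

lemma balanced_weight: "weight w = -1 \<longleftrightarrow> balanced (zeros w) (positives w)"
proof -
  have "weight w = (\<Sum>p\<leftarrow>positives w. int (snd p)) - int (length (zeros w)) - int (length (positives w))"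
    by (induction w) auto
  moreover have "(\<Sum>p\<leftarrow>positives w. int (snd p)) = int (\<Sum>p\<leftarrow>positives w. snd p)"
    by (induction w) auto
  ultimately show ?thesis by (auto simp: balanced_def)
qed

lemma monomial_single [simp]: "monomial [(x, 0)] = x"
  by (simp add: monomial_def)

lemma monomial_mset:
  assumes "mset v = mset w"
  shows "monomial v = monomial w"
proof (cases "weight v = -1")
  case True
  then have bal: "balanced (zeros v) (positives v)" by (simp add: balanced_weight)
  have z: "mset (zeros v) = mset (zeros w)" and p: "mset (positives v) = mset (positives w)"
    using assms by simp_all
  have "collapse (zeros v) (positives v) = collapse (zeros w) (positives v)"
    using bal z by (rule collapse_mset_left)
  also have "\<dots> = collapse (zeros w) (positives w)"
    using balanced_mset[OF z bal] p by (rule collapse_mset_right)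
  finally show ?thesis using True weight_mset[OF assms] by (simp add: monomial_def)
qed (use weight_mset[OF assms] in \<open>simp add: monomial_def\<close>)

lemma replace_each_raise_positive:
  "l \<in> set (replace_each raise ps) \<Longrightarrow> \<forall>p\<in>set ps. 0 < snd p \<Longrightarrow> \<forall>p\<in>set l. 0 < snd p"
  by (induction ps arbitrary: l) (simp, fastforce)

text \<open>
  The homomorphism property: in the model this is \<open>v d(w)\<close> with \<open>d(w)\<close> expanded by the Leibniz
  rule.
\<close>

lemma star_monomial:
  assumes v: "weight v = -1" and w: "weight w = -1"
  shows "monomial v \<star> monomial w = (\<Sum>l\<leftarrow>replace_each raise w. monomial (v @ l))"
proof -
  let ?u = "monomial v"
  define zs ps where "zs = zeros w" and "ps = positives w"
  have bv: "balanced (zeros v) (positives v)" and bw: "balanced zs ps"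
    using v w by (simp_all add: balanced_weight zs_def ps_def)
  have u: "?u = collapse (zeros v) (positives v)" using v by (simp add: monomial_def)
  have split: "zeros (v @ map (\<lambda>z. (z, 0)) xs @ qs) = zeros v @ xs"
    "positives (v @ map (\<lambda>z. (z, 0)) xs @ qs) = positives v @ qs"
    if "\<forall>q\<in>set qs. 0 < snd q" for xs qs
    using that by (auto simp: filter_map comp_def filter_empty_conv filter_id_conv)
  have mon: "monomial (v @ map (\<lambda>z. (z, 0)) xs @ qs) = collapse (?u # xs) qs"
    if "\<forall>q\<in>set qs. 0 < snd q" "weight (map (\<lambda>z. (z, 0)) xs @ qs) = 0" for xs qs
    using that(2) v split[OF that(1), of xs] collapse_append[OF bv, of xs qs]
    unfolding monomial_def u by (simp add: weight_def)
  have pos: "\<forall>p\<in>set ps. 0 < snd p" by (simp add: ps_def)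
  have perm: "mset w = mset (map (\<lambda>z. (z, 0)) zs @ ps)"
  proof -
    have "map (\<lambda>z. (z, 0)) zs = filter (\<lambda>p. snd p = 0) w"
      unfolding zs_def by (induction w) auto
    then show ?thesis unfolding ps_def
      using multiset_partition[of "mset w" "\<lambda>p. snd p = 0"] by simp
  qed
  have wt: "weight (map (\<lambda>z. (z, 0)) zs) + weight ps = -1"
    using weight_mset[OF perm] w by simp
  \<comment> \<open>Differentiating an underived factor \<open>y\<close> gives a factor \<open>d(y)\<close>, which absorbs the value of \<open>v\<close>.\<close>
  have *: "(\<Sum>l\<leftarrow>replace_each raise (map (\<lambda>z. (z, 0)) ys). monomial (v @ map (\<lambda>z. (z, 0)) xs @ l @ ps))
      = (\<Sum>l\<leftarrow>replace_each ((\<star>) ?u) ys. collapse (xs @ l) ps)" if "xs @ ys = zs" for xs ys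
    using that
  proof (induction ys arbitrary: xs)
    case (Cons y ys)
    have "monomial (v @ map (\<lambda>z. (z, 0)) xs @ (y, Suc 0) # map (\<lambda>z. (z, 0)) ys @ ps)
        = monomial (v @ map (\<lambda>z. (z, 0)) (xs @ ys) @ (y, Suc 0) # ps)"
      by (rule monomial_mset) simp
    also have "\<dots> = collapse (?u # xs @ ys) ((y, Suc 0) # ps)"
      using wt Cons.prems[symmetric] pos by (intro mon) auto
    also have "\<dots> = collapse ((?u \<star> y) # xs @ ys) ps" by simp
    also have "\<dots> = collapse (xs @ (?u \<star> y) # ys) ps"
      using bw by (intro collapse_mset_left) (auto simp: balanced_def Cons.prems[symmetric])
    finally show ?case using Cons.IH[of "xs @ [y]"] Cons.prems by (simp add: comp_def)
  qed simp
  have "(\<Sum>l\<leftarrow>replace_each raise w. monomial (v @ l))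
      = (\<Sum>l\<leftarrow>replace_each raise (map (\<lambda>z. (z, 0)) zs @ ps). monomial (v @ l))"
    by (rule sum_list_replace_each_symmetric[OF monomial_mset perm]) simp
  also have "\<dots> = (\<Sum>l\<leftarrow>replace_each ((\<star>) ?u) zs. collapse l ps)
      + (\<Sum>q\<leftarrow>replace_each raise ps. monomial (v @ map (\<lambda>z. (z, 0)) zs @ q))"
    using *[of "[]" zs] by (simp add: replace_each_append comp_def)
  also have "(\<Sum>q\<leftarrow>replace_each raise ps. monomial (v @ map (\<lambda>z. (z, 0)) zs @ q))
      = (\<Sum>q\<leftarrow>replace_each raise ps. collapse (?u # zs) q)"
    using wt pos
    by (intro arg_cong[where f = sum_list] map_cong refl mon)
       (auto dest: replace_each_raise_positive weight_replace_each_raise)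
  also have "(\<Sum>l\<leftarrow>replace_each ((\<star>) ?u) zs. collapse l ps) + \<dots> = ?u \<star> collapse zs ps"
    by (rule star_collapse[OF bw, symmetric])
  finally show ?thesis using w by (simp add: monomial_def zs_def ps_def)
qed

end

section \<open>Words of weight minus one in a differential ring\<close>

locale derivation =
  fixes d :: "'a::ring_1 \<Rightarrow> 'a"
  assumes d_add: "d (x + y) = d x + d y"
    and d_mult: "d (x * y) = d x * y + x * d y"
begin

definition word_value :: "('a \<times> nat) list \<Rightarrow> 'a" where
  "word_value w = (\<Prod>(a, k)\<leftarrow>w. (d ^^ k) a)"

lemma word_value_simps [simp]:
  "word_value [] = 1" "word_value ((a, k) # w) = (d ^^ k) a * word_value w"
  "word_value (v @ w) = word_value v * word_value w"
  by (simp_all add: word_value_def)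

lemma d_word_value: "d (word_value w) = (\<Sum>l\<leftarrow>replace_each raise w. word_value l)"
proof (induction w)
  case Nil
  have "d 1 = d (1 * 1)" by simp
  also have "\<dots> = d 1 + d 1" by (subst d_mult) simp
  finally show ?case by simp
qed (auto simp: d_mult comp_def sum_list_const_mult)

end

text \<open>
  The two operations of a \<open>Der As2\<close>-algebra, for an additive subgroup of an associative
  ring with derivation.
\<close>

locale closed_under_derived_products = derivation +
  fixes P :: "'a set"
  assumes zero_mem: "0 \<in> P" and add_mem: "x \<in> P \<Longrightarrow> y \<in> P \<Longrightarrow> x + y \<in> P"
    and diff_mem: "x \<in> P \<Longrightarrow> y \<in> P \<Longrightarrow> x - y \<in> P"
    and succ_mem: "x \<in> P \<Longrightarrow> y \<in> P \<Longrightarrow> d x * y \<in> P"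
    and prec_mem: "x \<in> P \<Longrightarrow> y \<in> P \<Longrightarrow> x * d y \<in> P"
begin

lemma sum_list_mem: "(\<And>l. l \<in> set ls \<Longrightarrow> f l \<in> P) \<Longrightarrow> (\<Sum>l\<leftarrow>ls. f l) \<in> P"
  by (induction ls) (auto simp: zero_mem add_mem)

definition admissible :: "('a \<times> nat) list \<Rightarrow> bool" where
  "admissible w \<longleftrightarrow> fst ` set w \<subseteq> P \<and> weight w = -1"

lemma admissible_replace_each:
  assumes "l \<in> set (replace_each raise w)"
  shows "fst ` set l = fst ` set w" "weight l = weight w + 1" "length l = length w"
proof -
  show "fst ` set l = fst ` set w"
    using assms by (induction w arbitrary: l) (auto, (force simp: image_iff)+)
qed (use assms weight_replace_each_raise length_replace_each in blast)+

text \<open>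
  The subword \<open>z d(y)\<close>, where \<open>z\<close> is the last underived letter before \<open>y\<close>, lies in \<open>P\<close> and may serve
  as a single underived letter. This shortens the word.
\<close>

lemma mem_zeros_then_one:
  assumes shorter: "\<And>v. length v < length ((x, 0) # s @ (y, 1) # t) \<Longrightarrow> admissible v \<Longrightarrow> word_value v \<in> P"
    and admissible: "admissible ((x, 0) # s @ (y, 1) # t)" and s: "\<forall>p\<in>set s. snd p = 0"
  shows "word_value ((x, 0) # s @ (y, 1) # t) \<in> P"
proof -
  obtain s' z where "(x, 0) # s = s' @ [(z, 0)]"
    using s by (cases s rule: rev_cases) auto
  then have *: "(x, 0) # s @ (y, 1) # t = s' @ (z, 0) # (y, 1) # t"
    by (metis append.assoc append_Cons append_Nil)
  have "word_value (s' @ (z * d y, 0) # t) \<in> P"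
    using admissible unfolding * by (intro shorter[unfolded *]) (auto simp: admissible_def prec_mem)
  then show ?thesis unfolding * by (simp add: mult.assoc)
qed

text \<open>
  Lower the order of the first derived letter by one, remove \<open>x\<close> and let \<open>u\<close> be the remaining word,
  of weight \<open>-1\<close>. Then \<open>x d(u)\<close> is the given word plus corrections. If the derivative falls on an
  underived letter before \<open>y\<close>, \<open>mem_zeros_then_one\<close> applies; if it falls behind \<open>y\<close>, the order of the
  first derived letter has dropped.
\<close>

lemma mem_zeros_then_positive:
  assumes shorter: "\<And>v. length v < length ((x, 0) # s @ (y, Suc m) # t) \<Longrightarrow> admissible v \<Longrightarrow> word_value v \<in> P"
    and admissible: "admissible ((x, 0) # s @ (y, Suc m) # t)" and s: "\<forall>p\<in>set s. snd p = 0"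
  shows "word_value ((x, 0) # s @ (y, Suc m) # t) \<in> P"
  using shorter admissible
proof (induction m arbitrary: t)
  case 0
  then show ?case using mem_zeros_then_one[OF _ _ s, of x y t] by simp
next
  case (Suc m)
  let ?r = "(y, Suc m) # t"
  have "x * d (word_value (s @ ?r)) \<in> P"
    using Suc.prems by (intro prec_mem Suc.prems(1)) (auto simp: admissible_def)
  moreover have "word_value ((x, 0) # s @ (y, Suc m) # l) \<in> P" if "l \<in> set (replace_each raise t)" for l
    using Suc.prems admissible_replace_each[OF that] by (intro Suc.IH) (auto simp: admissible_def)
  moreover have "word_value ((x, 0) # l @ ?r) \<in> P" if l: "l \<in> set (replace_each raise s)" for l
  proof -
    from l obtain a z b where "l = a @ (z, 1) # b" "s = a @ (z, 0) # b"
      using s by (auto dest!: in_set_replace_each)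
    with Suc.prems s show ?thesis
      using mem_zeros_then_one[of x a z "b @ ?r"] by (auto simp: admissible_def)
  qed
  ultimately have "x * d (word_value (s @ ?r))
      - (\<Sum>l\<leftarrow>replace_each raise s. word_value ((x, 0) # l @ ?r))
      - (\<Sum>l\<leftarrow>replace_each raise t. word_value ((x, 0) # s @ (y, Suc m) # l)) \<in> P"
    by (intro diff_mem sum_list_mem)
  also have "x * d (word_value (s @ ?r))
      - (\<Sum>l\<leftarrow>replace_each raise s. word_value ((x, 0) # l @ ?r))
      - (\<Sum>l\<leftarrow>replace_each raise t. word_value ((x, 0) # s @ (y, Suc m) # l))
      = word_value ((x, 0) # s @ (y, Suc (Suc m)) # t)"
    unfolding d_word_value replace_each_append
    by (simp add: comp_def distrib_left sum_list_const_mult[symmetric])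
  finally show ?case .
qed

text \<open>
  Reading a word from its end, the weight starts at zero and drops by at most one per letter.
\<close>

lemma word_split:
  assumes "weight w \<le> -1"
  obtains v u where "w = v @ u" "weight u = -1"
  using assms
proof (induction w arbitrary: thesis)
  case (Cons p w)
  show ?case
  proof (cases "weight w \<le> -1")
    case True
    then show ?thesis using Cons.IH Cons.prems(1) by (metis append_Cons)
  next
    case False
    then have "weight (p # w) = -1" using Cons.prems(2) by simp
    then show ?thesis using Cons.prems(1)[of "[]"] by simp
  qed
qed simp

text \<open>
  Split off a suffix \<open>u\<close> of weight \<open>-1\<close>. Then \<open>d(d\<^sup>m(x) v) u\<close> is the given word plus words whose
  first letter has the lower order \<open>m\<close>.
\<close>

lemma mem_first_positive:
  assumes shorter: "\<And>v. length v < Suc (length w) \<Longrightarrow> admissible v \<Longrightarrow> word_value v \<in> P"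
    and lower: "\<And>w'. length w' = length w \<Longrightarrow> admissible ((x, m) # w') \<Longrightarrow> word_value ((x, m) # w') \<in> P"
    and admissible: "admissible ((x, Suc m) # w)"
  shows "word_value ((x, Suc m) # w) \<in> P"
proof -
  from admissible have "weight w \<le> -1" by (auto simp: admissible_def)
  then obtain v u where w: "w = v @ u" and u: "weight u = -1" by (rule word_split)
  have "u \<noteq> []" using u by auto
  have "d (word_value ((x, m) # v)) * word_value u \<in> P"
    using admissible u \<open>u \<noteq> []\<close> by (intro succ_mem shorter) (auto simp: admissible_def w)
  moreover have "word_value ((x, m) # l @ u) \<in> P" if "l \<in> set (replace_each raise v)" for l
    using admissible u admissible_replace_each[OF that] by (intro lower) (auto simp: admissible_def w)
  ultimately have "d (word_value ((x, m) # v)) * word_value u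
      - (\<Sum>l\<leftarrow>replace_each raise v. word_value ((x, m) # l @ u)) \<in> P"
    by (intro diff_mem sum_list_mem)
  also have "d (word_value ((x, m) # v)) * word_value u
      - (\<Sum>l\<leftarrow>replace_each raise v. word_value ((x, m) # l @ u)) = word_value ((x, Suc m) # w)"
    unfolding d_word_value
    by (simp add: w comp_def distrib_right mult.assoc sum_list_mult_const[symmetric])
  finally show ?thesis .
qed

theorem word_value_mem: "admissible w \<Longrightarrow> word_value w \<in> P"
proof (induction "length w" arbitrary: w rule: less_induct)
  case less
  then obtain x k w' where w: "w = (x, k) # w'" by (cases w) (auto simp: admissible_def)
  have "word_value ((x, k) # w') \<in> P" if "length w' < length w" "admissible ((x, k) # w')" for w'
    using that
  proof (induction k arbitrary: w')
    case 0
    show ?case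
    proof (cases w')
      case Nil
      then show ?thesis using 0 by (auto simp: admissible_def)
    next
      case Cons
      have "\<exists>p\<in>set w'. snd p \<noteq> 0"
      proof (rule ccontr)
        assume "\<not> ?thesis"
        then have "weight w' = - int (length w')" by (induction w') auto
        with 0 Cons show False by (simp add: admissible_def)
      qed
      then obtain s p t where "w' = s @ p # t" "snd p \<noteq> 0" "\<forall>q\<in>set s. snd q = 0"
        using split_list_first_prop[of w' "\<lambda>p. snd p \<noteq> 0"] by blast
      moreover obtain y m where "p = (y, Suc m)" using \<open>snd p \<noteq> 0\<close> by (cases p) (auto simp: gr0_conv_Suc)
      ultimately show ?thesis
        using 0 by (simp del: word_value_simps) (intro mem_zeros_then_positive less, auto)
    qed
  next
    case (Suc k)
    from Suc.prems show ?case
    proof (intro mem_first_positive)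
      show "word_value v \<in> P" if "length v < Suc (length w')" "admissible v" for v
        using that Suc.prems(1) by (intro less) auto
      show "word_value ((x, k) # u) \<in> P" if "length u = length w'" "admissible ((x, k) # u)" for u
        using that Suc.prems(1) by (intro Suc.IH) auto
    qed
  qed
  then show ?case using less.prems by (simp add: w)
qed

end

section \<open>Linear algebra of formal linear combinations\<close>

lemma lookup_scale_pm [simp]:
  "Poly_Mapping.lookup (scale_pm c p) x = c * Poly_Mapping.lookup p x"
  by (simp add: Poly_Mapping.map.rep_eq when_def)

interpretation pm: vector_space "scale_pm :: 'k::field \<Rightarrow> ('x \<Rightarrow>\<^sub>0 'k) \<Rightarrow> _"
  using module_scale_pm by (simp only: module_iff_vector_space)

lemma lin_ext_over:
  assumes "module scale" "finite A" "Poly_Mapping.keys p \<subseteq> A"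
  shows "lin_ext scale f p = (\<Sum>x\<in>A. scale (Poly_Mapping.lookup p x) (f x))"
proof -
  interpret module scale by fact
  show ?thesis unfolding lin_ext_def
    using assms by (intro sum.mono_neutral_left) (auto simp: in_keys_iff)
qed

lemma keys_scale_pm: "Poly_Mapping.keys (scale_pm c p) \<subseteq> Poly_Mapping.keys p"
  by (auto simp: in_keys_iff)

lemma lin_ext_scale:
  assumes "module scale"
  shows "lin_ext scale f (scale_pm c p) = scale c (lin_ext scale f p)"
proof -
  interpret module scale by fact
  show ?thesis
    using lin_ext_over[OF assms finite_keys keys_scale_pm, of f c p]
    by (simp add: lin_ext_def scale_sum_right)
qed

lemma lin_ext_single:
  assumes "module scale"
  shows "lin_ext scale f (Poly_Mapping.single x c) = scale c (f x)"
  using lin_ext_scale[OF assms, of f c "mono x"] by (simp add: lin_ext_mono[OF assms])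

lemma lin_ext_zero [simp]: "lin_ext scale f 0 = 0"
  by (simp add: lin_ext_def)

lemma linear_lin_ext:
  assumes "vector_space scale"
  shows "Vector_Spaces.linear scale_pm scale (lin_ext scale f)"
  using assms pm.vector_space_axioms lin_ext_add[of scale f] lin_ext_scale[of scale f]
  unfolding Vector_Spaces.linear_iff module_iff_vector_space by blast

lemma lin_ext_mem:
  assumes "module scale" "module.subspace scale S" "\<And>x. x \<in> Poly_Mapping.keys p \<Longrightarrow> f x \<in> S"
  shows "lin_ext scale f p \<in> S"
proof -
  interpret module scale by fact
  show ?thesis unfolding lin_ext_def
    using assms by (intro subspace_sum subspace_scale) auto
qed

lemma lin_ext_mono_id [simp]: "lin_ext scale_pm mono p = p"
proof (rule poly_mapping_eqI)
  fix x
  have "Poly_Mapping.lookup (lin_ext scale_pm mono p) x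
      = (\<Sum>y\<in>Poly_Mapping.keys p. if x = y then Poly_Mapping.lookup p y else 0)"
    unfolding lin_ext_def lookup_sum lookup_scale_pm lookup_single when_def
    by (intro sum.cong) auto
  also have "\<dots> = Poly_Mapping.lookup p x"
    by (simp add: in_keys_iff)
  finally show "Poly_Mapping.lookup (lin_ext scale_pm mono p) x = Poly_Mapping.lookup p x" .
qed

lemma pm_induct [case_names zero mono add scale]:
  fixes p :: "'x \<Rightarrow>\<^sub>0 'k::field"
  assumes "P 0" "\<And>x. x \<in> Poly_Mapping.keys p \<Longrightarrow> P (mono x)" "\<And>p q. P p \<Longrightarrow> P q \<Longrightarrow> P (p + q)"
    "\<And>c p. P p \<Longrightarrow> P (scale_pm c p)"
  shows "P p"
proof -
  have "lin_ext scale_pm mono p \<in> Collect P"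
    using assms by (intro lin_ext_mem module_scale_pm) (auto simp: pm.subspace_def)
  then show ?thesis by simp
qed

lemma lin_ext_compose:
  fixes p :: "'x \<Rightarrow>\<^sub>0 'k::field"
  assumes "module scale" "\<And>x y. g (x + y) = g x + g y" "\<And>c x. g (scale c x) = scale' c (g x)" "g 0 = 0"
  shows "g (lin_ext scale f p) = lin_ext scale' (\<lambda>x. g (f x)) p"
proof -
  have "g (sum h A) = (\<Sum>x\<in>A. g (h x))" for h and A :: "'x set"
    by (induction A rule: infinite_finite_induct) (auto simp: assms)
  then show ?thesis by (simp only: lin_ext_def assms(3))
qed

lemma linear_lin_ext_compose:
  assumes "Vector_Spaces.linear scale scale' g"
  shows "g (lin_ext scale f p) = lin_ext scale' (\<lambda>x. g (f x)) p"
proof -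
  interpret Vector_Spaces.linear scale scale' g by fact
  show ?thesis using vs1.module_axioms by (intro lin_ext_compose) (auto simp: add scale zero)
qed

text \<open>
  Quotients are realized on the original space, through a projection whose kernel is the given
  subspace.
\<close>

lemma (in vector_space) projection_along_subspace:
  assumes "subspace S"
  obtains \<pi> where "Vector_Spaces.linear scale scale \<pi>" "\<And>x. x - \<pi> x \<in> S" "\<And>x. x \<in> S \<Longrightarrow> \<pi> x = 0"
proof -
  interpret vs: vector_space_pair scale scale by unfold_locales
  obtain B where B: "B \<subseteq> S" "independent B" "S \<subseteq> span B" by (rule maximal_independent_subset)
  define C where "C = extend_basis B"
  have C: "B \<subseteq> C" "independent C" "span C = UNIV"
    using B(2) by (simp_all add: C_def extend_basis_superset independent_extend_basis span_extend_basis)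
  define \<pi> where "\<pi> = vs.construct C (\<lambda>b. if b \<in> B then 0 else b)"
  have lin: "Vector_Spaces.linear scale scale \<pi>"
    unfolding \<pi>_def by (rule vs.linear_construct[OF C(2)])
  then interpret \<pi>: Vector_Spaces.linear scale scale \<pi> .
  have \<pi>: "\<pi> b = (if b \<in> B then 0 else b)" if "b \<in> C" for b
    unfolding \<pi>_def using C(2) that by (rule vs.construct_basis)
  show ?thesis
  proof (rule that[OF lin])
    show "x - \<pi> x \<in> S" for x
    proof -
      have "x \<in> span C" by (simp add: C(3))
      then show ?thesis
      proof (induction rule: span_induct_alt)
        case base
        show ?case using assms by (simp add: \<pi>.zero subspace_0)
      next
        case (step c b y)
        have "b - \<pi> b \<in> S"
          using \<pi>[OF step(1)] B(1) subspace_0[OF assms] by (cases "b \<in> B") auto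
        from subspace_add[OF assms subspace_scale[OF assms this] step(2)]
        have "scale c (b - \<pi> b) + (y - \<pi> y) \<in> S" .
        then show ?case by (simp add: \<pi>.add \<pi>.scale algebra_simps)
      qed
    qed
    show "\<pi> x = 0" if "x \<in> S" for x
    proof -
      have "x \<in> span B" using that B(3) by blast
      then show ?thesis
      proof (induction rule: span_induct_alt)
        case (step c b y)
        then have "\<pi> b = 0" using \<pi>[of b] C(1) by (simp add: subset_iff)
        then show ?case using step(2) by (simp add: \<pi>.add \<pi>.scale)
      qed (simp add: \<pi>.zero)
    qed
  qed
qed

definition supported :: "'x set \<Rightarrow> ('x \<Rightarrow>\<^sub>0 'k::field) set" where
  "supported S = {p. Poly_Mapping.keys p \<subseteq> S}"

lemma subspace_supported: "pm.subspace (supported S)"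
  unfolding pm.subspace_def supported_def mem_Collect_eq
  by (intro conjI ballI allI impI order_trans[OF keys_add] order_trans[OF keys_scale_pm]) auto

lemma supported_mono [simp]: "mono x \<in> supported S \<longleftrightarrow> x \<in> S"
  by (simp add: supported_def)

lemma lin_ext_supported:
  assumes "p \<in> supported A" "\<And>x. x \<in> A \<Longrightarrow> f x \<in> supported B"
  shows "lin_ext scale_pm f p \<in> supported B"
  using assms by (intro lin_ext_mem module_scale_pm subspace_supported) (auto simp: supported_def)

text \<open>
  An element of a span is the image of a formal combination, whose support can be prescribed.
\<close>

lemma in_span_image:
  assumes "p \<in> pm.span (f ` S)"
  obtains g where "g \<in> supported S" "lin_ext scale_pm f g = p"
proof -
  have "\<exists>g\<in>supported S. lin_ext scale_pm f g = p"
    using assms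
  proof (induction rule: pm.span_induct_alt)
    case base
    show ?case using pm.subspace_0[OF subspace_supported] by force
  next
    case (step c x y)
    then obtain s g where "s \<in> S" "x = f s" "g \<in> supported S" "lin_ext scale_pm f g = y" by auto
    moreover from this have "scale_pm c (mono s) + g \<in> supported S"
      using subspace_supported by (intro pm.subspace_add pm.subspace_scale) auto
    ultimately show ?case
      by (intro bexI[of _ "scale_pm c (mono s) + g"])
        (simp_all add: lin_ext_simps[OF module_scale_pm] lin_ext_single[OF module_scale_pm])
  qed
  with that show ?thesis by blast
qed

section \<open>The free associative differential algebra\<close>

text \<open>
  With concatenation as addition of indices, combinations of words form the free unital associative
  algebra, with its convolution product as ring multiplication.
\<close>

instantiation list :: (type) monoid_add
begin
definition zero_list where "zero_list = ([] :: 'a list)"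
definition plus_list where "plus_list = ((@) :: 'a list \<Rightarrow> _)"
instance by standard (simp_all add: zero_list_def plus_list_def)
end

lemma mono_mult [simp]: "mono u * mono v = (mono (u @ v) :: 'x list \<Rightarrow>\<^sub>0 'k::field)"
  by (simp add: mult_single plus_list_def)

lemma mono_Nil [simp]: "mono [] = (1 :: 'x list \<Rightarrow>\<^sub>0 'k::field)"
  by (metis single_one zero_list_def)

lemma scale_pm_eq_mult: "scale_pm c p = Poly_Mapping.single 0 c * (p :: 'x list \<Rightarrow>\<^sub>0 'k::field)"
  by (rule mult_map_scale_conv_mult)

lemma scale_mult_left: "scale_pm c p * q = scale_pm c (p * q :: 'x list \<Rightarrow>\<^sub>0 'k::field)"
  by (simp add: scale_pm_eq_mult mult.assoc)

lemma single_mono_commute: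
  "p * Poly_Mapping.single 0 c = Poly_Mapping.single 0 c * (p :: 'x list \<Rightarrow>\<^sub>0 'k::field)"
proof (induction p rule: pm_induct)
  case (scale e p)
  have "scale_pm e p * Poly_Mapping.single 0 c = scale_pm e (Poly_Mapping.single 0 c * p)"
    by (simp only: scale_mult_left scale)
  also have "\<dots> = Poly_Mapping.single 0 c * scale_pm e p"
    by (simp only: scale_pm_eq_mult mult.assoc[symmetric] mult_single) (simp add: mult.commute)
  finally show ?case .
qed (simp_all add: mult_single distrib_left distrib_right)

lemma scale_mult_right: "p * scale_pm c q = scale_pm c (p * q :: 'x list \<Rightarrow>\<^sub>0 'k::field)"
  by (simp add: scale_pm_eq_mult mult.assoc[symmetric] single_mono_commute)

lemma supported_mult:
  fixes p q :: "'x list \<Rightarrow>\<^sub>0 'k::field"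
  assumes "p \<in> supported A" "q \<in> supported B" "\<And>u v. u \<in> A \<Longrightarrow> v \<in> B \<Longrightarrow> u @ v \<in> C"
  shows "p * q \<in> supported C"
proof -
  have "Poly_Mapping.keys (p * q) \<subseteq> {u @ v |u v. u \<in> Poly_Mapping.keys p \<and> v \<in> Poly_Mapping.keys q}"
    using keys_mult[of p q] by (simp add: plus_list_def)
  then show ?thesis using assms unfolding supported_def by blast
qed

type_synonym ('k, 'x) words = "('x \<times> nat) list \<Rightarrow>\<^sub>0 'k"

definition dif :: "('k, 'x) words \<Rightarrow> ('k::field, 'x) words" where
  "dif = lin_ext scale_pm (\<lambda>w. \<Sum>l\<leftarrow>replace_each raise w. mono l)"

lemma dif_mono: "dif (mono w) = (\<Sum>l\<leftarrow>replace_each raise w. mono l)"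
  by (simp add: dif_def lin_ext_mono module_scale_pm)

lemma dif_add: "dif (p + q) = dif p + dif q"
  by (simp add: dif_def lin_ext_add module_scale_pm)

lemma dif_diff: "dif (p - q) = dif p - dif q"
  by (simp add: dif_def lin_ext_diff module_scale_pm)

lemma dif_scale: "dif (scale_pm c p) = scale_pm c (dif p)"
  by (simp add: dif_def lin_ext_scale module_scale_pm)

lemma dif_zero [simp]: "dif 0 = 0"
  by (simp add: dif_def)

lemma dif_mult: "dif (p * q) = dif p * q + p * dif q"
proof (induction p rule: pm_induct)
  case (mono u)
  show ?case
  proof (induction q rule: pm_induct)
    case (mono v)
    show ?case
      by (simp add: dif_mono replace_each_append comp_def sum_list_const_mult[symmetric]
          sum_list_mult_const[symmetric])
  qed (simp_all add: dif_add dif_scale scale_mult_right distrib_left pm.scale_right_distrib)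
qed (simp_all add: dif_add dif_scale scale_mult_left distrib_right pm.scale_right_distrib)

interpretation dif: derivation dif
  by unfold_locales (simp_all add: dif_add dif_mult)

abbreviation homogeneous :: "int \<Rightarrow> ('k::field, 'x) words set" where
  "homogeneous n \<equiv> supported {w. weight w = n}"

lemma dif_supported:
  fixes p :: "('k::field, 'x) words"
  assumes "p \<in> supported A" "\<And>w l. w \<in> A \<Longrightarrow> l \<in> set (replace_each raise w) \<Longrightarrow> l \<in> B"
  shows "dif p \<in> supported B"
proof -
  have *: "(\<Sum>l\<leftarrow>ls. mono l) \<in> (supported B :: (_ \<Rightarrow>\<^sub>0 'k) set)" if "set ls \<subseteq> B" for ls
    using that subspace_supported by (induction ls) (auto intro: pm.subspace_0 pm.subspace_add)
  show ?thesis
    unfolding dif_def using assms by (intro lin_ext_supported * subsetI)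
qed

lemma dif_homogeneous: "p \<in> homogeneous n \<Longrightarrow> dif p \<in> homogeneous (n + 1)"
  by (erule dif_supported) (auto dest: weight_replace_each_raise)

lemma dif_same_letters: "p \<in> supported {w. map fst w = xs} \<Longrightarrow> dif p \<in> supported {w. map fst w = xs}"
  by (erule dif_supported) (auto dest!: in_set_replace_each)

text \<open>
  The value of a term in the free differential algebra for the derived operations \<open>d(a) b\<close> and
  \<open>a d(b)\<close>.
\<close>

primrec expand :: "'x op_term \<Rightarrow> ('k::field, 'x) words" where
  "expand (Var x) = mono [(x, 0)]"
| "expand (s \<succ>\<^sub>T t) = dif (expand s) * expand t"
| "expand (s \<prec>\<^sub>T t) = expand s * dif (expand t)"

lemma expand_homogeneous: "(expand t :: ('k::field, 'x) words) \<in> homogeneous (-1)"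
proof (induction t)
  case (Succ s t)
  from dif_homogeneous[OF Succ(1)] have "(dif (expand s) :: ('k, 'x) words) \<in> homogeneous 0" by simp
  from this Succ(2) show ?case unfolding expand.simps by (rule supported_mult) auto
next
  case (Prec s t)
  from dif_homogeneous[OF Prec(2)] have "(dif (expand t) :: ('k, 'x) words) \<in> homogeneous 0" by simp
  from Prec(1) this show ?case unfolding expand.simps by (rule supported_mult) auto
qed simp

lemma expand_letters: "expand t \<in> supported {w. map fst w = word_part t}"
proof (induction t)
  case (Succ s t)
  from dif_same_letters[OF Succ(1)] Succ(2) show ?case
    unfolding expand.simps by (rule supported_mult) auto
next
  case (Prec s t)
  from Prec(1) dif_same_letters[OF Prec(2)] show ?case
    unfolding expand.simps by (rule supported_mult) auto
qed simp

lemma dif_power_letter: "(dif ^^ k) (mono [(x, 0)]) = mono [(x, k)]"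
  by (induction k) (auto simp: dif_mono)

lemma word_value_letters:
  "dif.word_value (map (\<lambda>(x, k). (mono [(x, 0)], k)) w) = mono w"
  by (induction w) (auto simp: dif_power_letter)

lemma succ_span_expand:
  assumes "p \<in> pm.span (range expand)" "q \<in> pm.span (range expand)"
  shows "dif p * q \<in> pm.span (range expand)"
  using assms(1)
proof (induction rule: pm.span_induct_alt)
  case base
  then show ?case by (simp add: pm.span_zero)
next
  case (step c x y)
  then obtain s where s: "x = expand s" by auto
  have "dif (expand s) * q \<in> pm.span (range expand)"
    using assms(2)
  proof (induction rule: pm.span_induct_alt)
    case base
    then show ?case by (simp add: pm.span_zero)
  next
    case (step c x y)
    then obtain t where t: "x = expand t" by auto
    have "expand (s \<succ>\<^sub>T t) \<in> pm.span (range expand)"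
      by (blast intro: pm.span_base)
    then show ?case using step(2)
      unfolding t
      by (auto simp: distrib_left scale_mult_right intro: pm.span_add pm.span_scale)
  qed
  then show ?case using step(2)
    unfolding s
      by (auto simp: dif_add dif_scale distrib_right scale_mult_left intro: pm.span_add pm.span_scale)
qed

lemma prec_span_expand:
  assumes "p \<in> pm.span (range expand)" "q \<in> pm.span (range expand)"
  shows "p * dif q \<in> pm.span (range expand)"
  using assms(1)
proof (induction rule: pm.span_induct_alt)
  case base
  then show ?case by (simp add: pm.span_zero)
next
  case (step c x y)
  then obtain s where s: "x = expand s" by auto
  have "expand s * dif q \<in> pm.span (range expand)"
    using assms(2)
  proof (induction rule: pm.span_induct_alt)
    case base
    then show ?case by (simp add: pm.span_zero)
  next
    case (step c x y)
    then obtain t where t: "x = expand t" by auto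
    have "expand (s \<prec>\<^sub>T t) \<in> pm.span (range expand)"
      by (blast intro: pm.span_base)
    then show ?case using step(2)
      unfolding t
      by (auto simp: dif_add dif_scale distrib_left scale_mult_right intro: pm.span_add pm.span_scale)
  qed
  then show ?case using step(2)
    unfolding s
      by (auto simp: distrib_right scale_mult_left intro: pm.span_add pm.span_scale)
qed

text \<open>
  Words of weight \<open>-1\<close> are word values with generators as letters, and the span of the expansions is
  closed under the two derived operations.
\<close>

theorem homogeneous_in_span_expand:
  fixes p :: "('k::field, 'x) words"
  assumes "p \<in> homogeneous (-1)"
  shows "p \<in> pm.span (range expand)"
proof -
  interpret closed_under_derived_products dif "pm.span (range (expand :: _ \<Rightarrow> ('k, 'x) words))"
  proof unfold_locales
    fix p q :: "('k, 'x) words"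
    assume pq: "p \<in> pm.span (range expand)" "q \<in> pm.span (range expand)"
    show "dif p * q \<in> pm.span (range expand)" by (rule succ_span_expand[OF pq])
    show "p * dif q \<in> pm.span (range expand)" by (rule prec_span_expand[OF pq])
  qed (simp_all add: pm.span_zero pm.span_add pm.span_diff)
  have "mono w \<in> pm.span (range (expand :: _ \<Rightarrow> ('k, 'x) words))" if "weight w = -1" for w
  proof -
    have "mono [(x, 0)] \<in> pm.span (range (expand :: _ \<Rightarrow> ('k, 'x) words))" for x
      by (rule pm.span_base) (metis expand.simps(1) rangeI)
    moreover have "weight (map (\<lambda>(x, k). (mono [(x, 0)] :: ('k, 'x) words, k)) w) = weight w"
      by (induction w) auto
    ultimately have "admissible (map (\<lambda>(x, k). (mono [(x, 0)], k)) w)"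
      using that by (auto simp: admissible_def)
    from word_value_mem[OF this] show ?thesis by (simp only: word_value_letters)
  qed
  then have "lin_ext scale_pm mono p \<in> pm.span (range (expand :: _ \<Rightarrow> ('k, 'x) words))"
    using assms by (intro lin_ext_mem module_scale_pm pm.subspace_span) (auto simp: supported_def)
  then show ?thesis by simp
qed

section \<open>The free Novikov algebra\<close>

definition comp_pm :: "('x magma \<Rightarrow>\<^sub>0 'k) \<Rightarrow> ('x magma \<Rightarrow>\<^sub>0 'k) \<Rightarrow> ('x magma \<Rightarrow>\<^sub>0 'k::field)" where
  "comp_pm p q = lin_ext scale_pm (\<lambda>s. lin_ext scale_pm (\<lambda>t. mono (s \<circ>\<^sub>N t)) q) p"

lemmas pm_simps = lin_ext_simps[OF module_scale_pm] lin_ext_scale[OF module_scale_pm]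

lemma comp_pm_mono_left: "comp_pm (mono s) q = lin_ext scale_pm (\<lambda>t. mono (s \<circ>\<^sub>N t)) q"
  by (simp add: comp_pm_def pm_simps)

lemma comp_pm_mono_right: "comp_pm p (mono t) = lin_ext scale_pm (\<lambda>s. mono (s \<circ>\<^sub>N t)) p"
  by (simp add: comp_pm_def pm_simps)

lemma comp_pm_mono: "comp_pm (mono s) (mono t) = mono (s \<circ>\<^sub>N t)"
  by (simp add: comp_pm_mono_left pm_simps)

lemma comp_pm_add_left: "comp_pm (p + p') q = comp_pm p q + comp_pm p' q"
  and comp_pm_diff_left: "comp_pm (p - p') q = comp_pm p q - comp_pm p' q"
  and comp_pm_scale_left: "comp_pm (scale_pm c p) q = scale_pm c (comp_pm p q)"
  and comp_pm_zero_left: "comp_pm 0 q = 0"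
  by (simp_all add: comp_pm_def pm_simps)

lemma comp_pm_add_right: "comp_pm p (q + q') = comp_pm p q + comp_pm p q'"
  by (induction p rule: pm_induct)
    (simp_all add: comp_pm_mono_left pm_simps comp_pm_add_left comp_pm_scale_left comp_pm_zero_left
      pm.scale_right_distrib)

lemma comp_pm_scale_right: "comp_pm p (scale_pm c q) = scale_pm c (comp_pm p q)"
  by (induction p rule: pm_induct)
    (simp_all add: comp_pm_mono_left pm_simps comp_pm_add_left comp_pm_scale_left comp_pm_zero_left
      pm.scale_right_distrib pm.scale_left_commute)

lemma comp_pm_zero_right: "comp_pm p 0 = 0"
  using comp_pm_add_right[of p 0 0] by simp

lemma comp_pm_diff_right: "comp_pm p (q - q') = comp_pm p q - comp_pm p q'"
  using comp_pm_add_right[of p "q - q'" q'] by simp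

lemma comp_pm_nov_rels_left:
  assumes "p \<in> pm.span nov_rels"
  shows "comp_pm p q \<in> pm.span nov_rels"
proof (induction q rule: pm_induct)
  case (mono t)
  show ?case
    using assms
  proof (induction rule: pm.span_induct_alt)
    case (step c x y)
    have "comp_pm x (mono t) \<in> nov_rels"
      unfolding comp_pm_mono_right using step(1) by (rule nov_rels.mult_right)
    then show ?case
      unfolding comp_pm_add_left comp_pm_scale_left
      by (intro pm.span_add pm.span_scale pm.span_base step(2))
  qed (simp add: comp_pm_zero_left pm.span_zero)
qed (simp_all add: comp_pm_zero_right comp_pm_add_right comp_pm_scale_right pm.span_zero
    pm.span_add pm.span_scale)

lemma comp_pm_nov_rels_right:
  assumes "q \<in> pm.span nov_rels"
  shows "comp_pm p q \<in> pm.span nov_rels"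
proof (induction p rule: pm_induct)
  case (mono t)
  show ?case
    using assms
  proof (induction rule: pm.span_induct_alt)
    case (step c x y)
    have "comp_pm (mono t) x \<in> nov_rels"
      unfolding comp_pm_mono_left using step(1) by (rule nov_rels.mult_left)
    then show ?case
      unfolding comp_pm_add_right comp_pm_scale_right
      by (intro pm.span_add pm.span_scale pm.span_base step(2))
  qed (simp add: comp_pm_zero_right pm.span_zero)
qed (simp_all add: comp_pm_zero_left comp_pm_add_left comp_pm_scale_left pm.span_zero
    pm.span_add pm.span_scale)

text \<open>
  A projection along the relations: the product \<open>nov_proj (comp_pm p q)\<close> turns the free nonassociative
  algebra itself into a Novikov algebra, with an isomorphic copy of the free one as its image.
\<close>

definition nov_proj :: "('x magma \<Rightarrow>\<^sub>0 'k) \<Rightarrow> ('x magma \<Rightarrow>\<^sub>0 'k::field)" where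
  "nov_proj = (SOME \<pi>. Vector_Spaces.linear scale_pm scale_pm \<pi> \<and>
     (\<forall>p. p - \<pi> p \<in> pm.span nov_rels) \<and> (\<forall>p\<in>pm.span nov_rels. \<pi> p = 0))"

lemma nov_proj:
  shows linear_nov_proj: "Vector_Spaces.linear scale_pm scale_pm (nov_proj :: ('x magma \<Rightarrow>\<^sub>0 'k) \<Rightarrow> ('x magma \<Rightarrow>\<^sub>0 'k::field))"
    and diff_nov_proj: "(p :: 'x magma \<Rightarrow>\<^sub>0 'k) - nov_proj p \<in> pm.span nov_rels"
    and nov_proj_eq_0: "p \<in> pm.span nov_rels \<Longrightarrow> nov_proj p = 0"
proof -
  obtain \<pi> :: "('x magma \<Rightarrow>\<^sub>0 'k) \<Rightarrow> ('x magma \<Rightarrow>\<^sub>0 'k)"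
    where "Vector_Spaces.linear scale_pm scale_pm \<pi>" "\<And>p. p - \<pi> p \<in> pm.span nov_rels"
      "\<And>p. p \<in> pm.span nov_rels \<Longrightarrow> \<pi> p = 0"
    by (rule pm.projection_along_subspace[OF pm.subspace_span]) blast
  then have "\<exists>\<pi>::('x magma \<Rightarrow>\<^sub>0 'k) \<Rightarrow> _. Vector_Spaces.linear scale_pm scale_pm \<pi> \<and>
     (\<forall>p. p - \<pi> p \<in> pm.span nov_rels) \<and> (\<forall>p\<in>pm.span nov_rels. \<pi> p = 0)"
    by blast
  from someI_ex[OF this]
  show "Vector_Spaces.linear scale_pm scale_pm (nov_proj :: ('x magma \<Rightarrow>\<^sub>0 'k) \<Rightarrow> _)"
    "p - nov_proj p \<in> pm.span nov_rels" "p \<in> pm.span nov_rels \<Longrightarrow> nov_proj p = 0"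
    unfolding nov_proj_def[symmetric] by auto
qed

interpretation nov_proj: Vector_Spaces.linear scale_pm scale_pm "nov_proj :: ('x magma \<Rightarrow>\<^sub>0 'k) \<Rightarrow> ('x magma \<Rightarrow>\<^sub>0 'k::field)"
  by (rule linear_nov_proj)

lemma nov_proj_eqI: "p - q \<in> pm.span nov_rels \<Longrightarrow> nov_proj p = nov_proj q"
  using nov_proj_eq_0[of "p - q"] by (simp add: nov_proj.diff)

lemma nov_proj_comp_left [simp]: "nov_proj (comp_pm (nov_proj p) q) = nov_proj (comp_pm p q)"
  by (rule nov_proj_eqI[symmetric])
    (simp only: comp_pm_diff_left[symmetric] comp_pm_nov_rels_left diff_nov_proj)

lemma nov_proj_comp_right [simp]: "nov_proj (comp_pm p (nov_proj q)) = nov_proj (comp_pm p q)"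
  by (rule nov_proj_eqI[symmetric])
    (simp only: comp_pm_diff_right[symmetric] comp_pm_nov_rels_right diff_nov_proj)

lemma comp_pm_right_commutative:
  "comp_pm (comp_pm u v) w - comp_pm (comp_pm u w) v \<in> pm.span (nov_rels :: ('x magma \<Rightarrow>\<^sub>0 'k::field) set)"
    (is "?f u v w \<in> ?S")
proof -
  have add: "\<And>u u' v w. ?f (u + u') v w = ?f u v w + ?f u' v w"
    "\<And>u v v' w. ?f u (v + v') w = ?f u v w + ?f u v' w"
    "\<And>u v w w'. ?f u v (w + w') = ?f u v w + ?f u v w'"
    by (simp_all add: comp_pm_add_left comp_pm_add_right)
  have scale: "\<And>c u v w. ?f (scale_pm c u) v w = scale_pm c (?f u v w)"
    "\<And>c u v w. ?f u (scale_pm c v) w = scale_pm c (?f u v w)"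
    "\<And>c u v w. ?f u v (scale_pm c w) = scale_pm c (?f u v w)"
    by (simp_all add: comp_pm_scale_left comp_pm_scale_right pm.scale_right_diff_distrib)
  have zero: "?f 0 v w = 0" "?f u 0 w = 0" "?f u v 0 = 0" for u v w
    by (simp_all add: comp_pm_zero_left comp_pm_zero_right)
  have m: "?f (mono a) (mono b) (mono c) \<in> ?S" for a b c
    by (simp only: comp_pm_mono) (rule pm.span_base, rule nov_rels.right_commutative)
  have "?f (mono a) (mono b) w \<in> ?S" for a b
    by (induction w rule: pm_induct) (simp_all only: m add scale zero pm.span_zero pm.span_add pm.span_scale)
  then have "?f (mono a) v w \<in> ?S" for a
    by (induction v rule: pm_induct) (simp_all only: add scale zero pm.span_zero pm.span_add pm.span_scale)
  then show ?thesis
    by (induction u rule: pm_induct) (simp_all only: add scale zero pm.span_zero pm.span_add pm.span_scale)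
qed

lemma comp_pm_left_symmetric:
  "comp_pm (comp_pm u v) w - comp_pm u (comp_pm v w) - comp_pm (comp_pm v u) w + comp_pm v (comp_pm u w)
     \<in> pm.span (nov_rels :: ('x magma \<Rightarrow>\<^sub>0 'k::field) set)"
    (is "?f u v w \<in> ?S")
proof -
  have add: "\<And>u u' v w. ?f (u + u') v w = ?f u v w + ?f u' v w"
    "\<And>u v v' w. ?f u (v + v') w = ?f u v w + ?f u v' w"
    "\<And>u v w w'. ?f u v (w + w') = ?f u v w + ?f u v w'"
    by (simp_all add: comp_pm_add_left comp_pm_add_right)
  have scale: "\<And>c u v w. ?f (scale_pm c u) v w = scale_pm c (?f u v w)"
    "\<And>c u v w. ?f u (scale_pm c v) w = scale_pm c (?f u v w)"
    "\<And>c u v w. ?f u v (scale_pm c w) = scale_pm c (?f u v w)"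
    by (simp_all add: comp_pm_scale_left comp_pm_scale_right pm.scale_right_diff_distrib pm.scale_right_distrib)
  have zero: "?f 0 v w = 0" "?f u 0 w = 0" "?f u v 0 = 0" for u v w
    by (simp_all add: comp_pm_zero_left comp_pm_zero_right)
  have m: "?f (mono a) (mono b) (mono c) \<in> ?S" for a b c
    by (simp only: comp_pm_mono) (rule pm.span_base, rule nov_rels.left_symmetric)
  have "?f (mono a) (mono b) w \<in> ?S" for a b
    by (induction w rule: pm_induct) (simp_all only: m add scale zero pm.span_zero pm.span_add pm.span_scale)
  then have "?f (mono a) v w \<in> ?S" for a
    by (induction v rule: pm_induct) (simp_all only: add scale zero pm.span_zero pm.span_add pm.span_scale)
  then show ?thesis
    by (induction u rule: pm_induct) (simp_all only: add scale zero pm.span_zero pm.span_add pm.span_scale)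
qed

interpretation free_novikov: novikov "\<lambda>p q. nov_proj (comp_pm p q :: 'x magma \<Rightarrow>\<^sub>0 'k::field)"
proof
  fix u v w :: "'x magma \<Rightarrow>\<^sub>0 'k"
  show "nov_proj (comp_pm (u + v) w) = nov_proj (comp_pm u w) + nov_proj (comp_pm v w)"
    "nov_proj (comp_pm u (v + w)) = nov_proj (comp_pm u v) + nov_proj (comp_pm u w)"
    by (simp_all add: comp_pm_add_left comp_pm_add_right nov_proj.add)
  show "nov_proj (comp_pm (nov_proj (comp_pm u v)) w) = nov_proj (comp_pm (nov_proj (comp_pm u w)) v)"
    unfolding nov_proj_comp_left by (rule nov_proj_eqI) (rule comp_pm_right_commutative)
  show "nov_proj (comp_pm (nov_proj (comp_pm u v)) w) - nov_proj (comp_pm u (nov_proj (comp_pm v w)))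
      = nov_proj (comp_pm (nov_proj (comp_pm v u)) w) - nov_proj (comp_pm v (nov_proj (comp_pm u w)))"
    unfolding nov_proj_comp_left nov_proj_comp_right
    using nov_proj_eq_0[OF comp_pm_left_symmetric[of u v w]]
    by (simp add: nov_proj.add nov_proj.diff algebra_simps)
qed

definition word_nov :: "('x \<times> nat) list \<Rightarrow> ('x magma \<Rightarrow>\<^sub>0 'k::field)" where
  "word_nov w = free_novikov.monomial (map (apfst (\<lambda>x. nov_proj (mono (Gen x)))) w)"

lemma word_nov_mset: "mset v = mset w \<Longrightarrow> word_nov v = word_nov w"
  unfolding word_nov_def by (rule free_novikov.monomial_mset) simp

lemma weight_map_apfst [simp]: "weight (map (apfst f) w) = weight w"
  by (simp add: weight_def comp_def)

lemma word_nov_product: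
  assumes "weight v = -1" "weight w = -1"
  shows "(\<Sum>l\<leftarrow>replace_each raise w. word_nov (v @ l)) =
    nov_proj (comp_pm (word_nov v) (word_nov w :: 'x magma \<Rightarrow>\<^sub>0 'k::field))"
proof -
  have "replace_each raise (map (apfst (\<lambda>x. nov_proj (mono (Gen x)))) w)
      = map (map (apfst (\<lambda>x. nov_proj (mono (Gen x) :: 'x magma \<Rightarrow>\<^sub>0 'k)))) (replace_each raise w)"
    by (rule replace_each_map) (simp add: apfst_def apsnd_def map_prod_def split_beta)
  then show ?thesis
    using assms unfolding word_nov_def by (subst free_novikov.star_monomial) (simp_all add: comp_def)
qed

lemma lin_ext_sum_list:
  assumes "module scale"
  shows "lin_ext scale f (\<Sum>l\<leftarrow>ls. g l) = (\<Sum>l\<leftarrow>ls. lin_ext scale f (g l))"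
  by (induction ls) (simp_all add: lin_ext_add[OF assms])

abbreviation words_nov :: "('k::field, 'x) words \<Rightarrow> ('x magma \<Rightarrow>\<^sub>0 'k)" where
  "words_nov \<equiv> lin_ext scale_pm word_nov"

lemma words_nov_prec:
  assumes p: "p \<in> homogeneous (-1)" and q: "q \<in> homogeneous (-1)"
  shows "words_nov (p * dif q) = nov_proj (comp_pm (words_nov p) (words_nov q))"
proof (induction p rule: pm_induct)
  case (mono v)
  then have v: "weight v = -1" using p by (auto simp: supported_def)
  show ?case
  proof (induction q rule: pm_induct)
    case (mono w)
    then have "weight w = -1" using q by (auto simp: supported_def)
    then show ?case
      by (simp add: dif_mono sum_list_const_mult[symmetric] lin_ext_sum_list[OF module_scale_pm]
          pm_simps word_nov_product[OF v])
  qed (simp_all add: dif_add dif_scale distrib_left scale_mult_right pm_simps comp_pm_zero_right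
      comp_pm_add_right comp_pm_scale_right nov_proj.add nov_proj.scale nov_proj.zero)
qed (simp_all add: distrib_right scale_mult_left pm_simps comp_pm_zero_left
      comp_pm_add_left comp_pm_scale_left nov_proj.add nov_proj.scale nov_proj.zero)

lemma words_nov_commute: "words_nov (p * q) = words_nov (q * p)"
proof (induction p rule: pm_induct)
  case (mono v)
  show ?case
  proof (induction q rule: pm_induct)
    case (mono w)
    show ?case by (simp add: pm_simps word_nov_mset[of "v @ w" "w @ v"])
  qed (simp_all add: distrib_left distrib_right scale_mult_left scale_mult_right pm_simps)
qed (simp_all add: distrib_left distrib_right scale_mult_left scale_mult_right pm_simps)

text \<open>
  The Novikov part of a term is determined by its expansion, even after the letters of all words
  have been made to commute. Both sides respect the two operations.
\<close>

lemma nov_proj_nov_part: "nov_proj (mono (nov_part t)) = words_nov (expand t :: ('k::field, 'x) words)"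
proof -
  have *: "nov_proj (mono (a \<circ>\<^sub>N b)) = nov_proj (comp_pm (nov_proj (mono a)) (nov_proj (mono b)))" for a b :: "'x magma"
    by (simp add: comp_pm_mono)
  show ?thesis
  proof (induction t)
    case (Var x)
    show ?case by (simp add: pm_simps word_nov_def)
  next
    case (Succ s t)
    show ?case
      unfolding expand.simps nov_part.simps *[of "nov_part t"] Succ
        words_nov_commute[of "dif (expand s)"]
      by (rule words_nov_prec[symmetric]) (rule expand_homogeneous)+
  next
    case (Prec s t)
    show ?case
      unfolding expand.simps nov_part.simps *[of "nov_part s"] Prec
      by (rule words_nov_prec[symmetric]) (rule expand_homogeneous)+
  qed
qed

section \<open>Expansions and the Hadamard product\<close>

definition tensor :: "('x magma \<Rightarrow>\<^sub>0 'k) \<Rightarrow> 'x list \<Rightarrow> ('x magma \<times> 'x list \<Rightarrow>\<^sub>0 'k::field)" where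
  "tensor p xs = lin_ext scale_pm (\<lambda>s. mono (s, xs)) p"

lemma tensor_simps:
  "tensor (p + q) xs = tensor p xs + tensor q xs" "tensor (p - q) xs = tensor p xs - tensor q xs"
  "tensor (scale_pm c p) xs = scale_pm c (tensor p xs)" "tensor 0 xs = 0"
  "tensor (mono s) xs = mono (s, xs)"
  by (simp_all add: tensor_def pm_simps)

lemma subspace_hadamard_kernel: "pm.subspace hadamard_kernel"
  unfolding hadamard_kernel_def by (rule pm.subspace_span)

lemma tensor_nov_rels:
  assumes "p \<in> pm.span nov_rels" "xs \<noteq> []"
  shows "tensor p xs \<in> hadamard_kernel"
  using assms(1)
proof (induction rule: pm.span_induct_alt)
  case base
  show ?case unfolding tensor_simps by (rule pm.subspace_0[OF subspace_hadamard_kernel])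
next
  case (step c x y)
  have "tensor x xs \<in> hadamard_kernel"
    unfolding hadamard_kernel_def tensor_def using step(1) assms(2) by (intro pm.span_base) blast
  then show ?case unfolding tensor_simps
    by (intro hadamard_kernel_add pm.subspace_scale[OF subspace_hadamard_kernel] step(2))
qed

text \<open>
  A map from the free associative differential algebra to the Hadamard product that inverts the
  expansion of terms modulo the kernel: the order of the letters is kept in the associative factor,
  their derivatives in the Novikov factor.
\<close>

definition words_tensor :: "('k::field, 'x) words \<Rightarrow> ('x magma \<times> 'x list \<Rightarrow>\<^sub>0 'k)" where
  "words_tensor = lin_ext scale_pm (\<lambda>w. tensor (word_nov w) (map fst w))"

lemma words_tensor_same_letters:
  assumes "p \<in> supported {w. map fst w = xs}"
  shows "words_tensor p = tensor (words_nov p) xs"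
proof (induction p rule: pm_induct)
  case (mono w)
  then show ?case using assms by (auto simp: words_tensor_def pm_simps supported_def)
qed (simp_all add: words_tensor_def pm_simps tensor_simps)

lemma term_tensor:
  "mono (nov_part t, word_part t) - words_tensor (expand t) \<in> (hadamard_kernel :: (_ \<Rightarrow>\<^sub>0 'k::field) set)"
proof -
  have "word_part t \<noteq> []" by (induction t) auto
  with diff_nov_proj have "tensor (mono (nov_part t) - nov_proj (mono (nov_part t))) (word_part t)
      \<in> (hadamard_kernel :: (_ \<Rightarrow>\<^sub>0 'k) set)"
    by (rule tensor_nov_rels)
  then show ?thesis
    by (simp only: words_tensor_same_letters[OF expand_letters] nov_proj_nov_part tensor_simps)
qed

text \<open>
  Permuting the letters of a word does not change its Novikov part, so the six words of a
  second-type relation give a second-type relation in the associative factor.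
\<close>

lemma words_tensor_as2_rels:
  assumes "p \<in> pm.span as2_rels"
  shows "words_tensor p \<in> (hadamard_kernel :: (_ \<Rightarrow>\<^sub>0 'k::field) set)"
  using assms
proof (induction rule: pm.span_induct_alt)
  case base
  show ?case unfolding words_tensor_def by (simp add: pm.subspace_0[OF subspace_hadamard_kernel])
next
  case (step c x y)
  from step(1) obtain l u v w r where ne: "u \<noteq> []" "v \<noteq> []" "w \<noteq> []"
    and x: "x = mono (l @ u @ v @ w @ r) - mono (l @ v @ u @ w @ r) - mono (l @ u @ w @ v @ r)
      + mono (l @ w @ u @ v @ r) + mono (l @ v @ w @ u @ r) - mono (l @ w @ v @ u @ r)"
    unfolding as2_rels_def by blast
  let ?N = "word_nov (l @ u @ v @ w @ r) :: _ \<Rightarrow>\<^sub>0 'k"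
  let ?f = "map fst"
  have N: "word_nov (l @ v @ u @ w @ r) = ?N" "word_nov (l @ u @ w @ v @ r) = ?N"
    "word_nov (l @ w @ u @ v @ r) = ?N" "word_nov (l @ v @ w @ u @ r) = ?N"
    "word_nov (l @ w @ v @ u @ r) = ?N"
    by (rule word_nov_mset, simp)+
  define rel where "rel N = tensor N (?f l @ ?f u @ ?f v @ ?f w @ ?f r)
      - tensor N (?f l @ ?f v @ ?f u @ ?f w @ ?f r) - tensor N (?f l @ ?f u @ ?f w @ ?f v @ ?f r)
      + tensor N (?f l @ ?f w @ ?f u @ ?f v @ ?f r) + tensor N (?f l @ ?f v @ ?f w @ ?f u @ ?f r)
      - tensor N (?f l @ ?f w @ ?f v @ ?f u @ ?f r)" for N :: "'a magma \<Rightarrow>\<^sub>0 'k"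
  have "rel N \<in> hadamard_kernel" for N
  proof (induction N rule: pm_induct)
    case zero
    show ?case by (simp add: rel_def tensor_simps pm.subspace_0[OF subspace_hadamard_kernel])
  next
    case (mono t)
    let ?q = "mono (?f l @ ?f u @ ?f v @ ?f w @ ?f r) - mono (?f l @ ?f v @ ?f u @ ?f w @ ?f r)
      - mono (?f l @ ?f u @ ?f w @ ?f v @ ?f r) + mono (?f l @ ?f w @ ?f u @ ?f v @ ?f r)
      + mono (?f l @ ?f v @ ?f w @ ?f u @ ?f r) - mono (?f l @ ?f w @ ?f v @ ?f u @ ?f r) :: _ \<Rightarrow>\<^sub>0 'k"
    have "?q \<in> as2_rels" unfolding as2_rels_def using ne by blast
    then have "lin_ext scale_pm (\<lambda>w. mono (t, w)) ?q \<in> (hadamard_kernel :: (_ \<Rightarrow>\<^sub>0 'k) set)"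
      unfolding hadamard_kernel_def by (intro pm.span_base) blast
    then show ?case by (simp add: rel_def tensor_simps pm_simps)
  next
    case (add p q)
    have "rel (p + q) = rel p + rel q" by (simp add: rel_def tensor_simps)
    with add show ?case by (simp add: hadamard_kernel_add)
  next
    case (scale c p)
    have "rel (scale_pm c p) = scale_pm c (rel p)"
      by (simp add: rel_def tensor_simps pm.scale_right_distrib pm.scale_right_diff_distrib)
    with scale show ?case by (simp add: pm.subspace_scale[OF subspace_hadamard_kernel])
  qed
  moreover have "words_tensor x = rel ?N"
    by (simp add: x words_tensor_def pm_simps N rel_def)
  ultimately have "words_tensor x \<in> hadamard_kernel" by simp
  then have "scale_pm c (words_tensor x) + words_tensor y \<in> hadamard_kernel"
    by (intro hadamard_kernel_add pm.subspace_scale[OF subspace_hadamard_kernel] step(2))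
  then show ?case by (simp add: words_tensor_def pm_simps)
qed

text \<open>
  Modulo the kernel, the Hadamard image of a term is computed from its expansion alone, by a linear
  map that sends second-type relations to the kernel.
\<close>

theorem vanishing_expansion_in_kernel:
  fixes f :: "'x op_term \<Rightarrow>\<^sub>0 'k::field"
  assumes "lin_ext scale_pm expand f \<in> pm.span as2_rels"
  shows "lin_ext scale_pm (\<lambda>t. mono (nov_part t, word_part t)) f \<in> hadamard_kernel"
proof -
  have "lin_ext scale_pm (\<lambda>t. mono (nov_part t, word_part t)) f
      - words_tensor (lin_ext scale_pm expand f) \<in> hadamard_kernel"
    (is "?D f \<in> _")
  proof (induction f rule: pm_induct)
    case zero
    show ?case by (simp add: words_tensor_def pm.subspace_0[OF subspace_hadamard_kernel])
  next
    case (mono t)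
    show ?case using term_tensor[of t] by (simp add: pm_simps)
  next
    case (add p q)
    have "?D (p + q) = ?D p + ?D q" by (simp add: words_tensor_def pm_simps)
    with add show ?case by (simp only: hadamard_kernel_add)
  next
    case (scale c p)
    have "?D (scale_pm c p) = scale_pm c (?D p)"
      by (simp add: words_tensor_def pm_simps pm.scale_right_diff_distrib)
    with scale show ?case by (simp only: pm.subspace_scale[OF subspace_hadamard_kernel])
  qed
  from hadamard_kernel_add[OF this words_tensor_as2_rels[OF assms]] show ?thesis by simp
qed

section \<open>Renaming letters\<close>

lemma lin_ext_cong:
  "(\<And>x. x \<in> Poly_Mapping.keys p \<Longrightarrow> f x = g x) \<Longrightarrow> lin_ext scale f p = lin_ext scale g p"
  by (simp add: lin_ext_def)

definition rename :: "('x \<Rightarrow> 'y) \<Rightarrow> ('k::field, 'x) words \<Rightarrow> ('k, 'y) words" where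
  "rename \<rho> = lin_ext scale_pm (\<lambda>w. mono (map (apfst \<rho>) w))"

lemma rename_simps:
  "rename \<rho> (p + q) = rename \<rho> p + rename \<rho> q" "rename \<rho> (p - q) = rename \<rho> p - rename \<rho> q"
  "rename \<rho> (scale_pm c p) = scale_pm c (rename \<rho> p)" "rename \<rho> 0 = 0"
  "rename \<rho> (mono w) = mono (map (apfst \<rho>) w)"
  by (simp_all add: rename_def pm_simps)

lemma rename_mult: "rename \<rho> (p * q) = rename \<rho> p * rename \<rho> q"
proof (induction p rule: pm_induct)
  case (mono v)
  show ?case
    by (induction q rule: pm_induct) (simp_all add: rename_simps distrib_left scale_mult_right)
qed (simp_all add: rename_simps distrib_right scale_mult_left)

lemma rename_dif: "rename \<rho> (dif p) = dif (rename \<rho> p)"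
proof (induction p rule: pm_induct)
  case (mono v)
  have "replace_each raise (map (apfst \<rho>) v) = map (map (apfst \<rho>)) (replace_each raise v)"
    by (rule replace_each_map) (simp add: apfst_def apsnd_def map_prod_def split_beta)
  then show ?case
    unfolding rename_simps dif_mono rename_def lin_ext_sum_list[OF module_scale_pm]
    by (simp add: pm_simps comp_def dif_mono)
qed (simp_all add: rename_simps dif_add dif_scale)

lemma expand_map: "expand (map_op_term \<rho> t) = rename \<rho> (expand t)"
  by (induction t) (simp_all add: rename_simps rename_mult rename_dif)

lemma word_part_map: "word_part (map_op_term \<rho> t) = map \<rho> (word_part t)"
  by (induction t) simp_all

lemma eval_term_map: "eval_term s p \<rho> (map_op_term \<pi> t) = eval_term s p (\<lambda>x. \<rho> (\<pi> x)) t"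
  by (induction t) simp_all

lemma eval_term_cong:
  "(\<And>x. x \<in> set (word_part t) \<Longrightarrow> \<rho> x = \<sigma> x) \<Longrightarrow> eval_term s p \<rho> t = eval_term s p \<sigma> t"
  by (induction t) simp_all

text \<open>
  Every term is a renaming of a multilinear one, in which the variables are numbered from left to
  right. White identities concern only multilinear terms.
\<close>

lemma labelled_term:
  "\<exists>t'. word_part t' = [m..<m + length (word_part t)] \<and>
     (\<forall>\<rho>. (\<forall>i<length (word_part t). \<rho> (m + i) = word_part t ! i) \<longrightarrow> map_op_term \<rho> t' = t)"
proof (induction t arbitrary: m)
  case (Var x)
  show ?case by (rule exI[of _ "Var m"]) simp
next
  case (Succ s t)
  obtain s' where s': "word_part s' = [m..<m + length (word_part s)]"
    "\<And>\<rho>. (\<forall>i<length (word_part s). \<rho> (m + i) = word_part s ! i) \<Longrightarrow> map_op_term \<rho> s' = s"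
    using Succ(1)[of m] by blast
  let ?m = "m + length (word_part s)"
  obtain t' where t': "word_part t' = [?m..<?m + length (word_part t)]"
    "\<And>\<rho>. (\<forall>i<length (word_part t). \<rho> (?m + i) = word_part t ! i) \<Longrightarrow> map_op_term \<rho> t' = t"
    using Succ(2)[of ?m] by blast
  have "word_part (s' \<succ>\<^sub>T t') = [m..<m + length (word_part (s \<succ>\<^sub>T t))]"
    using upt_add_eq_append[of m ?m "length (word_part t)"] by (simp add: s'(1) t'(1) add.assoc)
  moreover have "map_op_term \<rho> (s' \<succ>\<^sub>T t') = s \<succ>\<^sub>T t"
    if \<rho>: "\<forall>i<length (word_part (s \<succ>\<^sub>T t)). \<rho> (m + i) = word_part (s \<succ>\<^sub>T t) ! i" for \<rho>
  proof -
    have "map_op_term \<rho> s' = s" using \<rho> by (intro s'(2)) (simp add: nth_append)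
    moreover have "map_op_term \<rho> t' = t"
      using \<rho>[rule_format, of "length (word_part s) + i" for i]
      by (intro t'(2)) (simp add: nth_append add.assoc)
    ultimately show ?thesis by simp
  qed
  ultimately show ?case by blast
next
  case (Prec s t)
  obtain s' where s': "word_part s' = [m..<m + length (word_part s)]"
    "\<And>\<rho>. (\<forall>i<length (word_part s). \<rho> (m + i) = word_part s ! i) \<Longrightarrow> map_op_term \<rho> s' = s"
    using Prec(1)[of m] by blast
  let ?m = "m + length (word_part s)"
  obtain t' where t': "word_part t' = [?m..<?m + length (word_part t)]"
    "\<And>\<rho>. (\<forall>i<length (word_part t). \<rho> (?m + i) = word_part t ! i) \<Longrightarrow> map_op_term \<rho> t' = t"
    using Prec(2)[of ?m] by blast
  have "word_part (s' \<prec>\<^sub>T t') = [m..<m + length (word_part (s \<prec>\<^sub>T t))]"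
    using upt_add_eq_append[of m ?m "length (word_part t)"] by (simp add: s'(1) t'(1) add.assoc)
  moreover have "map_op_term \<rho> (s' \<prec>\<^sub>T t') = s \<prec>\<^sub>T t"
    if \<rho>: "\<forall>i<length (word_part (s \<prec>\<^sub>T t)). \<rho> (m + i) = word_part (s \<prec>\<^sub>T t) ! i" for \<rho>
  proof -
    have "map_op_term \<rho> s' = s" using \<rho> by (intro s'(2)) (simp add: nth_append)
    moreover have "map_op_term \<rho> t' = t"
      using \<rho>[rule_format, of "length (word_part s) + i" for i]
      by (intro t'(2)) (simp add: nth_append add.assoc)
    ultimately show ?thesis by simp
  qed
  ultimately show ?case by blast
qed

section \<open>Terms for words\<close>

text \<open>
  The terms used for a word can be taken to have the same letters in the same order: the others
  expand to combinations of words with other letters and can be left out.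
\<close>

lemma span_expand_same_letters:
  fixes p :: "('k::field, 'x) words"
  assumes "p \<in> pm.span (range expand)" and p: "p \<in> supported {w. map fst w = xs}"
  shows "p \<in> pm.span (expand ` {t. word_part t = xs})"
proof -
  define restrict :: "('k, 'x) words \<Rightarrow> ('k, 'x) words"
    where "restrict = lin_ext scale_pm (\<lambda>w. if map fst w = xs then mono w else 0)"
  have restrict: "restrict (expand t) = (if word_part t = xs then expand t else 0)" for t
  proof -
    have "restrict (expand t) = lin_ext scale_pm (\<lambda>w. if word_part t = xs then mono w else 0) (expand t)"
      unfolding restrict_def using expand_letters[of t]
      by (intro lin_ext_cong) (auto simp: supported_def)
    also have "\<dots> = (if word_part t = xs then expand t else 0)"
      by (cases "word_part t = xs") (simp, simp add: lin_ext_def)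
    finally show ?thesis .
  qed
  have "restrict p \<in> pm.span (expand ` {t. word_part t = xs})"
    using assms(1)
  proof (induction rule: pm.span_induct_alt)
    case base
    show ?case by (simp add: restrict_def pm.span_zero)
  next
    case (step c x y)
    then obtain t where t: "x = expand t" by blast
    have "restrict x \<in> pm.span (expand ` {t. word_part t = xs})"
      unfolding t restrict by (simp add: pm.span_zero pm.span_base)
    then have "scale_pm c (restrict x) + restrict y \<in> pm.span (expand ` {t. word_part t = xs})"
      by (intro pm.span_add pm.span_scale step(2))
    then show ?case by (simp add: restrict_def pm_simps)
  qed
  moreover have "restrict p = lin_ext scale_pm mono p"
    unfolding restrict_def using p by (intro lin_ext_cong) (auto simp: supported_def)
  ultimately show ?thesis by simp
qed

definition word_term :: "('x \<times> nat) list \<Rightarrow> ('x op_term \<Rightarrow>\<^sub>0 'k::field)" where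
  "word_term w = (SOME g. g \<in> supported {t. word_part t = map fst w} \<and> lin_ext scale_pm expand g = mono w)"

lemma word_term:
  assumes "weight w = -1"
  shows "(word_term w :: 'x op_term \<Rightarrow>\<^sub>0 'k::field) \<in> supported {t. word_part t = map fst w}"
    and "lin_ext scale_pm expand (word_term w) = (mono w :: ('k, 'x) words)"
proof -
  have "(mono w :: ('k, 'x) words) \<in> pm.span (expand ` {t. word_part t = map fst w})"
    using assms by (intro span_expand_same_letters homogeneous_in_span_expand) simp_all
  then have "\<exists>g::'x op_term \<Rightarrow>\<^sub>0 'k. g \<in> supported {t. word_part t = map fst w} \<and> lin_ext scale_pm expand g = mono w"
    by (elim in_span_image) blast
  from someI_ex[OF this]
  show "(word_term w :: 'x op_term \<Rightarrow>\<^sub>0 'k::field) \<in> supported {t. word_part t = map fst w}"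
    "lin_ext scale_pm expand (word_term w) = (mono w :: ('k, 'x) words)"
    unfolding word_term_def[symmetric] by auto
qed

lemma multilinear_iff:
  "multilinear n f \<longleftrightarrow> f \<in> supported {t. distinct (word_part t) \<and> set (word_part t) = {..<n}}"
  unfolding multilinear_def supported_def by blast

lemma supported_subset: "p \<in> supported A \<Longrightarrow> A \<subseteq> B \<Longrightarrow> p \<in> supported B"
  unfolding supported_def by blast

lemma multilinear_word_term:
  assumes "weight w = -1" "distinct (map fst w)" "set (map fst w) = {..<n}"
  shows "multilinear n (word_term w)"
  unfolding multilinear_iff
  by (rule supported_subset[OF word_term(1)[OF assms(1)]]) (use assms(2,3) in auto)

lemma zip_labels: "map (apfst ((!) (map fst w))) (zip [0..<length w] (map snd w)) = w"
  by (rule nth_equalityI) (auto intro: prod_eqI)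

section \<open>Evaluating words in a Der As2-algebra\<close>

context Der_As2_algebra
begin

lemma module_scale: "module scale" by (rule module_axioms)

lemmas ext_simps = lin_ext_simps[OF module_scale] lin_ext_scale[OF module_scale]

lemma vanishing_expansion:
  assumes "multilinear n f" "lin_ext scale_pm expand f \<in> pm.span as2_rels"
  shows "lin_ext scale (eval_term succ prec \<rho>) f = 0"
  using assms vanishing_expansion_in_kernel[OF assms(2)]
  by (intro white) (auto simp: white_identity_def)

text \<open>
  The letters are replaced by their positions, so that the word becomes multilinear; a term
  combination with this expansion is evaluated at the original letters.
\<close>

definition word_eval :: "('v \<times> nat) list \<Rightarrow> 'v" where
  "word_eval w = (if weight w = -1 then
     lin_ext scale (eval_term succ prec ((!) (map fst w))) (word_term (zip [0..<length w] (map snd w)))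
   else 0)"

text \<open>
  The numbering of the letters does not matter: two multilinear combinations of terms with the same
  expansion differ by a white identity.
\<close>

lemma word_eval_labelled:
  fixes w :: "(nat \<times> nat) list"
  assumes w: "weight w = -1" "distinct (map fst w)" "set (map fst w) = {..<n}"
  shows "word_eval (map (apfst \<rho>) w) = lin_ext scale (eval_term succ prec \<rho>) (word_term w)"
proof -
  define \<pi> where "\<pi> = (!) (map fst w)"
  define c where "c = zip [0..<length w] (map snd w)"
  have c: "map (apfst \<pi>) c = w" "map fst c = [0..<length w]" "map snd c = map snd w" "length c = length w"
    unfolding c_def \<pi>_def by (rule zip_labels) simp_all
  have "weight c = weight w"
    using arg_cong[OF c(3), of "\<lambda>ks. \<Sum>k\<leftarrow>ks. int k - 1"] by (simp add: weight_def comp_def)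
  with w(1) have wc: "weight c = -1" by simp
  define h where "h = lin_ext scale_pm (\<lambda>t. mono (map_op_term \<pi> t)) (word_term c :: nat op_term \<Rightarrow>\<^sub>0 'k)"
  have "map \<pi> [0..<length w] = map fst w"
    by (auto simp: \<pi>_def intro: nth_equalityI)
  then have "h \<in> supported {t. word_part t = map fst w}"
    unfolding h_def using word_term(1)[OF wc]
    by (intro lin_ext_supported) (auto simp: word_part_map c(2))
  then have "multilinear n h"
    unfolding multilinear_iff using w(2,3) by (elim supported_subset) auto
  then have m: "multilinear n (h - word_term w)"
    by (rule multilinear_diff) (rule multilinear_word_term[OF w])
  have "lin_ext scale_pm expand h = lin_ext scale_pm (\<lambda>t. rename \<pi> (expand t)) (word_term c)"
    unfolding h_def
    by (subst linear_lin_ext_compose[OF linear_lin_ext[OF pm.vector_space_axioms]])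
      (simp add: pm_simps expand_map)
  also have "\<dots> = rename \<pi> (lin_ext scale_pm expand (word_term c))"
    unfolding rename_def
    by (rule linear_lin_ext_compose[OF linear_lin_ext[OF pm.vector_space_axioms], symmetric])
  also have "\<dots> = mono w" by (simp add: word_term(2)[OF wc] rename_simps c(1))
  finally have "lin_ext scale_pm expand (h - word_term w) = 0"
    by (simp add: pm_simps word_term(2)[OF w(1)])
  then have "lin_ext scale (eval_term succ prec \<rho>) (h - word_term w) = 0"
    using m by (intro vanishing_expansion) (simp_all add: pm.span_zero)
  moreover have "lin_ext scale (eval_term succ prec \<rho>) h
      = lin_ext scale (\<lambda>t. eval_term succ prec (\<lambda>i. \<rho> (\<pi> i)) t) (word_term c)"
    unfolding h_def
    by (subst linear_lin_ext_compose[OF linear_lin_ext[OF vector_space_axioms]])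
      (simp add: ext_simps eval_term_map)
  moreover have "\<dots> = lin_ext scale (eval_term succ prec ((!) (map fst (map (apfst \<rho>) w)))) (word_term c)"
  proof (intro lin_ext_cong eval_term_cong)
    fix t x assume "t \<in> Poly_Mapping.keys (word_term c :: nat op_term \<Rightarrow>\<^sub>0 'k)" "x \<in> set (word_part t)"
    then have "x < length w" using word_term(1)[OF wc] by (auto simp: supported_def c(2))
    then show "\<rho> (\<pi> x) = map fst (map (apfst \<rho>) w) ! x" by (simp add: \<pi>_def)
  qed
  ultimately show ?thesis
    using w(1) by (simp add: word_eval_def ext_simps c_def comp_def)
qed

abbreviation ev :: "('k, 'v) words \<Rightarrow> 'v" where "ev \<equiv> lin_ext scale word_eval"

text \<open>
  A term \<open>t\<close> is a renaming of a multilinear term \<open>t'\<close>. The words in the expansion of \<open>t'\<close> are evaluated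
  through terms \<open>h\<close> of their own, but \<open>t'\<close> and \<open>h\<close> have the same expansion.
\<close>

lemma ev_expand: "ev (expand t) = eval_term succ prec (\<lambda>x. x) t"
proof -
  define \<rho> where "\<rho> = (!) (word_part t)"
  let ?n = "length (word_part t)"
  obtain t' where t': "word_part t' = [0..<?n]" "map_op_term \<rho> t' = t"
    using labelled_term[of 0 t] by (auto simp: \<rho>_def)
  let ?p = "expand t' :: ('k, nat) words"
  have w: "weight w = -1" "map fst w = [0..<?n]" if "w \<in> Poly_Mapping.keys ?p" for w
    using that expand_homogeneous[of t'] expand_letters[of t'] by (auto simp: supported_def t'(1))
  define h where "h = lin_ext scale_pm (word_term :: _ \<Rightarrow> nat op_term \<Rightarrow>\<^sub>0 'k) ?p"
  have "h \<in> supported {t. word_part t = [0..<?n]}"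
    unfolding h_def
  proof (rule lin_ext_mem[OF module_scale_pm subspace_supported])
    fix x assume x: "x \<in> Poly_Mapping.keys ?p"
    show "(word_term x :: nat op_term \<Rightarrow>\<^sub>0 'k) \<in> supported {t. word_part t = [0..<?n]}"
      using word_term(1)[OF w(1)[OF x]] w(2)[OF x] by simp
  qed
  then have "multilinear ?n h"
    unfolding multilinear_iff by (elim supported_subset) auto
  then have m: "multilinear ?n (mono t' - h)"
    by (intro multilinear_diff multilinear_mono) (auto simp: t')
  have "lin_ext scale_pm expand h = lin_ext scale_pm (\<lambda>w. lin_ext scale_pm expand (word_term w)) ?p"
    unfolding h_def
    by (rule linear_lin_ext_compose[OF linear_lin_ext[OF pm.vector_space_axioms]])
  also have "\<dots> = lin_ext scale_pm mono ?p"
    using w by (intro lin_ext_cong word_term(2)) auto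
  finally have "lin_ext scale_pm expand (mono t' - h) = 0" by (simp add: pm_simps)
  then have "lin_ext scale (eval_term succ prec \<rho>) (mono t' - h) = 0"
    using m by (intro vanishing_expansion) (simp_all add: pm.span_zero)
  then have "eval_term succ prec \<rho> t' = lin_ext scale (eval_term succ prec \<rho>) h"
    by (simp add: ext_simps)
  also have "\<dots> = lin_ext scale (\<lambda>w. lin_ext scale (eval_term succ prec \<rho>) (word_term w)) ?p"
    unfolding h_def
    by (rule linear_lin_ext_compose[OF linear_lin_ext[OF vector_space_axioms]])
  also have "\<dots> = lin_ext scale (\<lambda>w. word_eval (map (apfst \<rho>) w)) ?p"
    using w by (intro lin_ext_cong word_eval_labelled[symmetric, where n = ?n]) auto
  also have "\<dots> = ev (rename \<rho> ?p)"
    unfolding rename_def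
    by (subst linear_lin_ext_compose[OF linear_lin_ext[OF vector_space_axioms]]) (simp add: ext_simps)
  also have "rename \<rho> ?p = expand t" by (simp flip: expand_map add: t'(2))
  also have "eval_term succ prec \<rho> t' = eval_term succ prec (\<lambda>x. x) t"
    unfolding t'(2)[symmetric] eval_term_map ..
  finally show ?thesis by simp
qed

text \<open>
  The six words of a relation can be labelled consistently. The terms chosen for them then add up
  to a multilinear combination whose expansion is a second-type relation.
\<close>

lemma ev_as2_rels:
  assumes "q \<in> as2_rels"
  shows "ev q = 0"
proof -
  from assms obtain l u v w r where ne: "u \<noteq> []" "v \<noteq> []" "w \<noteq> []"
    and q: "q = mono (l @ u @ v @ w @ r) - mono (l @ v @ u @ w @ r) - mono (l @ u @ w @ v @ r)
      + mono (l @ w @ u @ v @ r) + mono (l @ v @ w @ u @ r) - mono (l @ w @ v @ u @ r)"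
    unfolding as2_rels_def by blast
  let ?W = "l @ u @ v @ w @ r"
  show ?thesis
  proof (cases "weight ?W = -1")
    case False
    then show ?thesis by (simp add: q ext_simps word_eval_def ac_simps)
  next
    case True
    define \<rho> where "\<rho> = (!) (map fst ?W)"
    define n where "n = length ?W"
    have "map (apfst \<rho>) (zip [0..<n] (map snd ?W)) = ?W"
      unfolding \<rho>_def n_def by (rule zip_labels)
    then obtain l' u' v' w' r' where c: "zip [0..<n] (map snd ?W) = l' @ u' @ v' @ w' @ r'"
      and eq: "l = map (apfst \<rho>) l'" "u = map (apfst \<rho>) u'" "v = map (apfst \<rho>) v'"
        "w = map (apfst \<rho>) w'" "r = map (apfst \<rho>) r'"
      unfolding map_eq_append_conv append_eq_map_conv by (elim exE conjE) (rule that, simp_all only:)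
    have "map fst (zip [0..<n] (map snd ?W)) = [0..<n]" by (simp add: n_def)
    then have fst: "map fst (l' @ u' @ v' @ w' @ r') = [0..<n]" by (simp only: c)
    have admissible: "weight z = -1 \<and> distinct (map fst z) \<and> set (map fst z) = {..<n}"
      if z: "mset z = mset (l' @ u' @ v' @ w' @ r')" for z
    proof -
      have "mset (map fst z) = mset [0..<n]" unfolding fst[symmetric] by (simp only: mset_map z)
      then have "distinct (map fst z) = distinct [0..<n]" "set (map fst z) = set [0..<n]"
        by (rule mset_eq_imp_distinct_iff, rule mset_eq_setD)
      moreover have "weight z = weight ?W"
        using weight_mset[OF z] by (simp add: eq)
      ultimately show ?thesis using True by auto
    qed
    let ?t = "word_term :: _ \<Rightarrow> nat op_term \<Rightarrow>\<^sub>0 'k"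
    let ?g = "?t (l' @ u' @ v' @ w' @ r') - ?t (l' @ v' @ u' @ w' @ r') - ?t (l' @ u' @ w' @ v' @ r')
      + ?t (l' @ w' @ u' @ v' @ r') + ?t (l' @ v' @ w' @ u' @ r') - ?t (l' @ w' @ v' @ u' @ r')"
    have t: "multilinear n (?t z)" "lin_ext scale_pm expand (?t z) = mono z"
      "lin_ext scale (eval_term succ prec \<rho>) (?t z) = word_eval (map (apfst \<rho>) z)"
      if z: "mset z = mset (l' @ u' @ v' @ w' @ r')" for z
      using admissible[OF z] multilinear_word_term[of z n] word_term(2)[of z] word_eval_labelled[of z n \<rho>] by auto
    have "multilinear n ?g"
      by (intro multilinear_add multilinear_diff t(1)) simp_all
    moreover have "lin_ext scale_pm expand ?g \<in> as2_rels"
    proof -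
      have ne': "u' \<noteq> []" "v' \<noteq> []" "w' \<noteq> []" using ne by (auto simp: eq)
      have "lin_ext scale_pm expand ?g = mono (l' @ u' @ v' @ w' @ r') - mono (l' @ v' @ u' @ w' @ r')
        - mono (l' @ u' @ w' @ v' @ r') + mono (l' @ w' @ u' @ v' @ r') + mono (l' @ v' @ w' @ u' @ r')
        - mono (l' @ w' @ v' @ u' @ r')"
        by (simp add: pm_simps t(2))
      then show ?thesis unfolding as2_rels_def mem_Collect_eq using ne' by blast
    qed
    ultimately have "lin_ext scale (eval_term succ prec \<rho>) ?g = 0"
      by (intro vanishing_expansion pm.span_base)
    then show ?thesis by (simp add: ext_simps t(3) q eq)
  qed
qed

lemma succ_simps: "succ (a + b) c = succ a c + succ b c" "succ c (a + b) = succ c a + succ c b"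
    "succ (scale k a) c = scale k (succ a c)" "succ c (scale k a) = scale k (succ c a)"
    "succ 0 c = 0" "succ c 0 = 0"
  and prec_simps: "prec (a + b) c = prec a c + prec b c" "prec c (a + b) = prec c a + prec c b"
    "prec (scale k a) c = scale k (prec a c)" "prec c (scale k a) = scale k (prec c a)"
    "prec 0 c = 0" "prec c 0 = 0"
proof -
  interpret sr: Vector_Spaces.linear scale scale "\<lambda>y. succ x y" for x by (rule linear_succ_right)
  interpret sl: Vector_Spaces.linear scale scale "\<lambda>x. succ x y" for y by (rule linear_succ_left)
  interpret pr: Vector_Spaces.linear scale scale "\<lambda>y. prec x y" for x by (rule linear_prec_right)
  interpret pl: Vector_Spaces.linear scale scale "\<lambda>x. prec x y" for y by (rule linear_prec_left)
  show "succ (a + b) c = succ a c + succ b c" "succ c (a + b) = succ c a + succ c b"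
    "succ (scale k a) c = scale k (succ a c)" "succ c (scale k a) = scale k (succ c a)"
    "succ 0 c = 0" "succ c 0 = 0"
    by (fact sl.add sr.add sl.scale sr.scale sl.zero sr.zero)+
  show "prec (a + b) c = prec a c + prec b c" "prec c (a + b) = prec c a + prec c b"
    "prec (scale k a) c = scale k (prec a c)" "prec c (scale k a) = scale k (prec c a)"
    "prec 0 c = 0" "prec c 0 = 0"
    by (fact pl.add pr.add pl.scale pr.scale pl.zero pr.zero)+
qed

lemma homogeneous_expansion:
  assumes "p \<in> homogeneous (-1)"
  obtains g :: "'x op_term \<Rightarrow>\<^sub>0 'k" where "p = lin_ext scale_pm expand g"
  using in_span_image[OF homogeneous_in_span_expand[OF assms]] by metis

lemma ev_expansion: "ev (lin_ext scale_pm expand g) = lin_ext scale (eval_term succ prec (\<lambda>x. x)) g"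
  by (subst linear_lin_ext_compose[OF linear_lin_ext[OF vector_space_axioms]]) (simp add: ev_expand)

text \<open>
  Elements of weight \<open>-1\<close> are expansions of terms, for which the claim is the definition of the
  evaluation.
\<close>

lemma ev_succ:
  assumes "p \<in> homogeneous (-1)" "q \<in> homogeneous (-1)"
  shows "ev (dif p * q) = succ (ev p) (ev q)"
proof -
  obtain g where p: "p = lin_ext scale_pm expand g" using assms(1) by (rule homogeneous_expansion)
  obtain h where q: "q = lin_ext scale_pm expand h" using assms(2) by (rule homogeneous_expansion)
  show ?thesis
    unfolding p q
  proof (induction g rule: pm_induct)
    case (mono s)
    show ?case
    proof (induction h rule: pm_induct)
      case (mono t)
      show ?case using ev_expand[of "s \<succ>\<^sub>T t"] by (simp add: pm_simps ev_expand)
    qed (simp_all add: pm_simps ext_simps succ_simps distrib_left scale_mult_right)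
  qed (simp_all add: pm_simps ext_simps succ_simps dif_add dif_scale distrib_right scale_mult_left)
qed

lemma ev_prec:
  assumes "p \<in> homogeneous (-1)" "q \<in> homogeneous (-1)"
  shows "ev (p * dif q) = prec (ev p) (ev q)"
proof -
  obtain g where p: "p = lin_ext scale_pm expand g" using assms(1) by (rule homogeneous_expansion)
  obtain h where q: "q = lin_ext scale_pm expand h" using assms(2) by (rule homogeneous_expansion)
  show ?thesis
    unfolding p q
  proof (induction g rule: pm_induct)
    case (mono s)
    show ?case
    proof (induction h rule: pm_induct)
      case (mono t)
      show ?case using ev_expand[of "s \<prec>\<^sub>T t"] by (simp add: pm_simps ev_expand)
    qed (simp_all add: pm_simps ext_simps prec_simps dif_add dif_scale distrib_left scale_mult_right)
  qed (simp_all add: pm_simps ext_simps prec_simps distrib_right scale_mult_left)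
qed

lemma ev_letter [simp]: "ev (mono [(x, 0)]) = x"
  using ev_expand[of "Var x"] by simp

lemma word_eval_letter [simp]: "word_eval [(x, 0)] = x"
  using ev_letter[of x] by (simp only: lin_ext_mono[OF module_scale])

lemma ev_homogeneous_0:
  assumes "p \<in> homogeneous n" "n \<noteq> -1"
  shows "ev p = 0"
proof -
  have "ev p = lin_ext scale (\<lambda>w. 0) p"
    using assms by (intro lin_ext_cong) (auto simp: word_eval_def supported_def)
  then show ?thesis by (simp add: lin_ext_def)
qed

lemma dif_funpow_homogeneous: "p \<in> homogeneous n \<Longrightarrow> (dif ^^ k) p \<in> homogeneous (n + int k)"
proof (induction k)
  case (Suc k)
  then show ?case using dif_homogeneous[of "(dif ^^ k) p" "n + int k"] by (simp add: ac_simps)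
qed simp

text \<open>
  In the square of the free differential algebra, written as functions on \<open>bool\<close>, the pairs of elements
  of weight \<open>-1\<close> with equal values are closed under the two derived operations. They contain the
  diagonal letters and the pair of \<open>f\<close> and \<open>g\<close>, and so each pair of words of weight \<open>-1\<close> that differ
  only in one place, where the first has \<open>d\<^sup>k(f)\<close> and the second \<open>d\<^sup>k(g)\<close>. In other weights both values are zero by definition.
\<close>

lemma ev_replace_letter:
  assumes f: "f \<in> homogeneous (-1)" "g \<in> homogeneous (-1)" "ev f = ev g"
  shows "ev (l * (dif ^^ k) f * r) = ev (l * (dif ^^ k) g * r)"
proof -
  define D :: "(bool \<Rightarrow> ('k, 'v) words) \<Rightarrow> bool \<Rightarrow> ('k, 'v) words" where "D h i = dif (h i)" for h i
  define P where "P = {h :: bool \<Rightarrow> ('k, 'v) words. (\<forall>i. h i \<in> homogeneous (-1)) \<and> ev (h True) = ev (h False)}"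
  have homog: "dif p * q \<in> homogeneous (-1)" "p * dif q \<in> homogeneous (-1)"
    if "p \<in> homogeneous (-1)" "q \<in> homogeneous (-1)" for p q :: "('k, 'v) words"
  proof -
    from dif_homogeneous[OF that(1)] that(2) show "dif p * q \<in> homogeneous (-1)"
      by (rule supported_mult) auto
    from that(1) dif_homogeneous[OF that(2)] show "p * dif q \<in> homogeneous (-1)"
      by (rule supported_mult) auto
  qed
  interpret closed_under_derived_products D P
  proof
    fix x y :: "bool \<Rightarrow> ('k, 'v) words"
    show "D (x + y) = D x + D y" "D (x * y) = D x * y + x * D y"
      by (simp_all add: fun_eq_iff D_def dif_add dif_mult)
    show "0 \<in> P" by (simp add: P_def pm.subspace_0[OF subspace_supported])
    assume "x \<in> P" "y \<in> P"
    then have x: "\<And>i. x i \<in> homogeneous (-1)" "ev (x True) = ev (x False)"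
      and y: "\<And>i. y i \<in> homogeneous (-1)" "ev (y True) = ev (y False)"
      by (simp_all add: P_def)
    show "x + y \<in> P" "x - y \<in> P"
      using x y by (simp_all add: P_def ext_simps pm.subspace_add[OF subspace_supported]
          pm.subspace_diff[OF subspace_supported])
    show "D x * y \<in> P" "x * D y \<in> P"
      using x y by (simp_all add: P_def D_def homog ev_succ ev_prec)
  qed
  have component: "word_value w i = dif.word_value (map (\<lambda>(h, k). (h i, k)) w)" for w i
  proof -
    have "(D ^^ k) h i = (dif ^^ k) (h i)" for k h by (induction k) (simp_all add: D_def)
    then show ?thesis by (induction w) auto
  qed
  let ?c = "\<lambda>w. map (\<lambda>(x, k). (\<lambda>i::bool. mono [(x, 0)] :: ('k, 'v) words, k)) w"
  let ?fg = "\<lambda>i. if i then f else g"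
  have words: "ev (mono u * (dif ^^ k) f * mono v) = ev (mono u * (dif ^^ k) g * mono v)" for u v
  proof (cases "weight u + weight v + int k = 0")
    case True
    let ?w = "?c u @ [(?fg, k)] @ ?c v"
    have "weight (?c u) = weight u" for u by (induction u) auto
    moreover have "?fg \<in> P" "(\<lambda>i. mono [(x, 0)]) \<in> P" for x
      using f by (simp_all add: P_def)
    ultimately have "admissible ?w"
      using True by (force simp: admissible_def)
    then have "word_value ?w \<in> P" by (rule word_value_mem)
    then have "ev (word_value ?w True) = ev (word_value ?w False)" by (simp add: P_def)
    moreover have "dif.word_value (map (\<lambda>(h, k). (h i, k)) (?c u)) = (mono u :: ('k, 'v) words)" for u i
      by (induction u) (auto simp: dif_power_letter)
    ultimately show ?thesis by (simp add: component mult.assoc del: word_value_simps)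
  next
    case False
    have "mono u * (dif ^^ k) h * mono v \<in> homogeneous (weight u + (-1 + int k) + weight v)"
      if "h \<in> homogeneous (-1)" for h
    proof (rule supported_mult)
      show "mono u * (dif ^^ k) h \<in> homogeneous (weight u + (-1 + int k))"
        by (rule supported_mult[OF _ dif_funpow_homogeneous[OF that], of _ "{u}"]) auto
    qed (auto intro: supported_mono[THEN iffD2])
    moreover have "weight u + (-1 + int k) + weight v \<noteq> -1" using False by simp
    ultimately have "ev (mono u * (dif ^^ k) h * mono v) = 0" if "h \<in> homogeneous (-1)" for h
      using ev_homogeneous_0 that by blast
    then show ?thesis using f by simp
  qed
  show ?thesis
  proof (induction l rule: pm_induct)
    case (mono u)
    show ?case
    proof (induction r rule: pm_induct)
      case (mono v)
      show ?case by (rule words)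
    qed (simp_all add: distrib_left scale_mult_right ext_simps)
  qed (simp_all add: distrib_right scale_mult_left ext_simps)
qed

section \<open>The enveloping algebra\<close>

text \<open>
  The unit has to be excluded: putting one argument equal to it in the second-type identity would
  make the algebra commutative.
\<close>

definition augmentation_ideal :: "('k, 'v) words set" where
  "augmentation_ideal = supported {w. w \<noteq> []}"

text \<open>
  The largest differential ideal of the free algebra that lies in the augmentation ideal and in the
  kernel of \<open>ev\<close>.
\<close>

definition null_ideal :: "('k, 'v) words set" where
  "null_ideal = {p \<in> augmentation_ideal. \<forall>l r k. ev (l * (dif ^^ k) p * r) = 0}"

lemma dif_funpow_linear:
  "(dif ^^ k) (p + q) = (dif ^^ k) p + (dif ^^ k) q"
  "(dif ^^ k) (scale_pm c p) = scale_pm c ((dif ^^ k) p)" "(dif ^^ k) 0 = 0"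
  by (induction k) (simp_all add: dif_add dif_scale)

lemma subspace_null_ideal: "pm.subspace null_ideal"
  unfolding pm.subspace_def null_ideal_def augmentation_ideal_def
  by (auto simp: dif_funpow_linear distrib_left distrib_right scale_mult_left scale_mult_right ext_simps
      pm.subspace_0[OF subspace_supported] pm.subspace_add[OF subspace_supported]
      pm.subspace_scale[OF subspace_supported])

lemma subspace_augmentation_ideal: "pm.subspace augmentation_ideal"
  unfolding augmentation_ideal_def by (rule subspace_supported)

lemma augmentation_mult_left: "p \<in> augmentation_ideal \<Longrightarrow> p * q \<in> augmentation_ideal"
  and augmentation_mult_right: "p \<in> augmentation_ideal \<Longrightarrow> q * p \<in> augmentation_ideal"
proof -
  have q: "q \<in> supported UNIV" by (simp add: supported_def)
  assume "p \<in> augmentation_ideal"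
  then have p: "p \<in> supported {w. w \<noteq> []}" by (simp add: augmentation_ideal_def)
  from p q show "p * q \<in> augmentation_ideal"
    unfolding augmentation_ideal_def by (rule supported_mult) simp
  from q p show "q * p \<in> augmentation_ideal"
    unfolding augmentation_ideal_def by (rule supported_mult) simp
qed

lemma dif_augmentation: "p \<in> augmentation_ideal \<Longrightarrow> dif p \<in> augmentation_ideal"
  unfolding augmentation_ideal_def by (erule dif_supported) (auto dest: length_replace_each)

lemma null_ideal_dif:
  assumes "p \<in> null_ideal"
  shows "dif p \<in> null_ideal"
proof -
  have "(dif ^^ k) (dif p) = (dif ^^ Suc k) p" for k by (simp add: funpow_swap1)
  with assms show ?thesis unfolding null_ideal_def by (simp add: dif_augmentation del: funpow.simps)
qed

lemma null_ideal_mult: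
  assumes "p \<in> null_ideal"
  shows "p * q \<in> null_ideal" "q * p \<in> null_ideal"
proof -
  have "\<forall>p\<in>null_ideal. \<forall>q l r. ev (l * (dif ^^ k) (p * q) * r) = 0 \<and> ev (l * (dif ^^ k) (q * p) * r) = 0" for k
  proof (induction k)
    case 0
    show ?case
    proof (intro ballI allI conjI)
      fix p q l r assume "p \<in> null_ideal"
      then have *: "ev (l * (dif ^^ 0) p * r) = 0" for l r unfolding null_ideal_def by blast
      show "ev (l * (dif ^^ 0) (p * q) * r) = 0" using *[of l "q * r"] by (simp add: mult.assoc)
      show "ev (l * (dif ^^ 0) (q * p) * r) = 0" using *[of "l * q" r] by (simp add: mult.assoc)
    qed
  next
    case (Suc k)
    then show ?case
      by (simp add: funpow_Suc_right dif_mult dif_funpow_linear distrib_left distrib_right ext_simps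
          null_ideal_dif del: funpow.simps)
  qed
  with assms show "p * q \<in> null_ideal" "q * p \<in> null_ideal"
    unfolding null_ideal_def by (auto simp: augmentation_mult_left augmentation_mult_right)
qed

text \<open>
  The second-type identity says that the standard polynomial of degree three vanishes.
\<close>

definition standard3 :: "('k, 'v) words \<Rightarrow> ('k, 'v) words \<Rightarrow> ('k, 'v) words \<Rightarrow> ('k, 'v) words" where
  "standard3 a b c = a * b * c - b * a * c - a * c * b + c * a * b + b * c * a - c * b * a"

lemma standard3_simps:
  "standard3 (a + a') b c = standard3 a b c + standard3 a' b c"
  "standard3 a (b + b') c = standard3 a b c + standard3 a b' c"
  "standard3 a b (c + c') = standard3 a b c + standard3 a b c'"
  "standard3 (scale_pm k a) b c = scale_pm k (standard3 a b c)"
  "standard3 a (scale_pm k b) c = scale_pm k (standard3 a b c)"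
  "standard3 a b (scale_pm k c) = scale_pm k (standard3 a b c)"
  "standard3 0 b c = 0" "standard3 a 0 c = 0" "standard3 a b 0 = 0"
  by (simp_all add: standard3_def distrib_left distrib_right scale_mult_left scale_mult_right
      pm.scale_right_distrib pm.scale_right_diff_distrib)

lemma dif_standard3:
  "dif (standard3 a b c) = standard3 (dif a) b c + standard3 a (dif b) c + standard3 a b (dif c)"
  by (simp add: standard3_def dif_add dif_diff dif_mult distrib_left distrib_right)

lemma ev_standard3:
  assumes "a \<in> augmentation_ideal" "b \<in> augmentation_ideal" "c \<in> augmentation_ideal"
  shows "ev (l * standard3 a b c * r) = 0"
proof -
  have words: "ev (mono x * standard3 (mono u) (mono v) (mono w) * mono y) = 0"
    if "u \<noteq> []" "v \<noteq> []" "w \<noteq> []" for x u v w y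
  proof -
    have "mono x * standard3 (mono u) (mono v) (mono w) * mono y \<in> as2_rels"
      unfolding as2_rels_def standard3_def mem_Collect_eq
      by (rule exI[of _ x], rule exI[of _ u], rule exI[of _ v], rule exI[of _ w], rule exI[of _ y])
        (simp add: that left_diff_distrib right_diff_distrib distrib_left distrib_right)
    then show ?thesis by (rule ev_as2_rels)
  qed
  note lin = standard3_simps distrib_left distrib_right scale_mult_left scale_mult_right ext_simps
    mult_zero_left mult_zero_right lin_ext_zero add_0 scale_zero_right
  have 1: "ev (mono x * standard3 (mono u) (mono v) c * mono y) = 0"
    if "u \<noteq> []" "v \<noteq> []" for x u v y
  proof (induction c rule: pm_induct)
    case (mono w)
    then show ?case using assms(3) that by (intro words) (auto simp: augmentation_ideal_def supported_def)
  qed (simp_all only: lin)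
  have 2: "ev (mono x * standard3 (mono u) b c * mono y) = 0" if "u \<noteq> []" for x u y
  proof (induction b rule: pm_induct)
    case (mono w)
    then show ?case using assms(2) that by (intro 1) (auto simp: augmentation_ideal_def supported_def)
  qed (simp_all only: lin)
  have 3: "ev (mono x * standard3 a b c * mono y) = 0" for x y
  proof (induction a rule: pm_induct)
    case (mono w)
    then show ?case using assms(1) by (intro 2) (auto simp: augmentation_ideal_def supported_def)
  qed (simp_all only: lin)
  have 4: "ev (mono x * standard3 a b c * r) = 0" for x
    by (induction r rule: pm_induct) (simp_all only: 3 lin)
  show ?thesis
    by (induction l rule: pm_induct) (simp_all only: 4 lin)
qed

lemma standard3_null:
  assumes "a \<in> augmentation_ideal" "b \<in> augmentation_ideal" "c \<in> augmentation_ideal"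
  shows "standard3 a b c \<in> null_ideal"
proof -
  have "ev (l * (dif ^^ k) (standard3 a b c) * r) = 0" for l k r
    using assms
  proof (induction k arbitrary: a b c)
    case 0
    then show ?case by (simp add: ev_standard3)
  next
    case (Suc k)
    then show ?case
      by (simp add: funpow_Suc_right dif_standard3 dif_funpow_linear distrib_left distrib_right ext_simps
          dif_augmentation del: funpow.simps)
  qed
  moreover have "standard3 a b c \<in> augmentation_ideal"
    unfolding standard3_def
    by (intro pm.subspace_add[OF subspace_augmentation_ideal]
        pm.subspace_diff[OF subspace_augmentation_ideal] augmentation_mult_left assms)
  ultimately show ?thesis by (simp add: null_ideal_def)
qed

lemma same_value_null:
  assumes "f \<in> homogeneous (-1)" "g \<in> homogeneous (-1)" "ev f = ev g"
  shows "f - g \<in> null_ideal"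
proof -
  have "f - g \<in> homogeneous (-1)"
    using assms by (intro pm.subspace_diff[OF subspace_supported])
  then have "f - g \<in> augmentation_ideal"
    unfolding augmentation_ideal_def by (rule supported_subset) auto
  moreover have "ev (l * (dif ^^ k) (f - g) * r) = 0" for l k r
  proof -
    have "(dif ^^ k) (f - g) = (dif ^^ k) f - (dif ^^ k) g"
      using dif_funpow_linear(1)[of k "f - g" g] by simp
    then show ?thesis
      using ev_replace_letter[OF assms, of l k r] by (simp add: left_diff_distrib right_diff_distrib ext_simps)
  qed
  ultimately show ?thesis by (simp add: null_ideal_def)
qed

text \<open>
  The projection \<open>\<pi>\<close> along the null ideal and the projection \<open>\<eta>\<close> that removes the constant term turn
  the space of all words into the direct sum of the quotient of the augmentation ideal by the null
  ideal and a space with zero product and zero derivation.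
\<close>

theorem embedding:
  "\<exists>(scaleA :: 'k \<Rightarrow> ('k, 'v) envelope \<Rightarrow> ('k, 'v) envelope) mult d \<phi>.
     As2_diff_algebra scaleA mult d \<and> Vector_Spaces.linear scale scaleA \<phi> \<and> inj \<phi> \<and>
     (\<forall>a b. \<phi> (succ a b) = mult (d (\<phi> a)) (\<phi> b)) \<and>
     (\<forall>a b. \<phi> (prec a b) = mult (\<phi> a) (d (\<phi> b)))"
proof -
  obtain \<pi> :: "('k, 'v) words \<Rightarrow> ('k, 'v) words"
    where \<pi>: "Vector_Spaces.linear scale_pm scale_pm \<pi>" "\<And>p. p - \<pi> p \<in> null_ideal"
      "\<And>p. p \<in> null_ideal \<Longrightarrow> \<pi> p = 0"
    by (rule pm.projection_along_subspace[OF subspace_null_ideal]) blast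
  interpret \<pi>: Vector_Spaces.linear scale_pm scale_pm \<pi> by (rule \<pi>(1))
  define \<eta> :: "('k, 'v) words \<Rightarrow> ('k, 'v) words"
    where "\<eta> = lin_ext scale_pm (\<lambda>w. if w = [] then 0 else mono w)"
  have \<eta>_simps: "\<eta> (p + q) = \<eta> p + \<eta> q" "\<eta> (p - q) = \<eta> p - \<eta> q" "\<eta> (scale_pm c p) = scale_pm c (\<eta> p)" for p q c
    by (simp_all add: \<eta>_def pm_simps)
  have \<eta>_aug: "\<eta> p \<in> augmentation_ideal" for p
    unfolding \<eta>_def augmentation_ideal_def
    by (intro lin_ext_mem[OF module_scale_pm subspace_supported])
      (simp add: pm.subspace_0[OF subspace_supported])
  have \<eta>_id: "\<eta> p = p" if "p \<in> augmentation_ideal" for p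
  proof -
    have "\<eta> p = lin_ext scale_pm mono p"
      unfolding \<eta>_def using that by (intro lin_ext_cong) (auto simp: augmentation_ideal_def supported_def)
    then show ?thesis by simp
  qed
  have \<pi>_eqI: "\<pi> p = \<pi> q" if "p - q \<in> null_ideal" for p q
    using \<pi>(3)[OF that] by (simp add: \<pi>.diff)
  have null: "p - \<eta> (\<pi> p) \<in> null_ideal" if "p \<in> augmentation_ideal" for p
  proof -
    have "p - \<eta> (\<pi> p) = \<eta> (p - \<pi> p)" using that by (simp add: \<eta>_simps \<eta>_id)
    also have "\<dots> = p - \<pi> p" using \<pi>(2)[of p] by (intro \<eta>_id) (simp add: null_ideal_def)
    finally show ?thesis using \<pi>(2) by simp
  qed
  have left: "\<pi> (\<eta> (\<pi> p) * q) = \<pi> (p * q)" if "p \<in> augmentation_ideal" for p q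
    by (rule \<pi>_eqI[symmetric]) (simp only: left_diff_distrib[symmetric] null_ideal_mult(1)[OF null[OF that]])
  have right: "\<pi> (q * \<eta> (\<pi> p)) = \<pi> (q * p)" if "p \<in> augmentation_ideal" for p q
    by (rule \<pi>_eqI[symmetric]) (simp only: right_diff_distrib[symmetric] null_ideal_mult(2)[OF null[OF that]])
  have dif: "\<pi> (dif (\<eta> (\<pi> p))) = \<pi> (dif p)" if "p \<in> augmentation_ideal" for p
    by (rule \<pi>_eqI[symmetric]) (simp only: dif_diff[symmetric] null_ideal_dif[OF null[OF that]])
  define mult where "mult x y = \<pi> (\<eta> x * \<eta> y)" for x y
  define d where "d x = \<pi> (dif (\<eta> x))" for x
  define \<phi> where "\<phi> v = \<pi> (mono [(v, 0)])" for v
  note aug = \<eta>_aug augmentation_mult_left[OF \<eta>_aug] dif_augmentation[OF \<eta>_aug]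
  have lin: "Vector_Spaces.linear scale_pm scale_pm f"
    if "\<And>x y. f (x + y) = f x + f y" "\<And>c x. f (scale_pm c x) = scale_pm c (f x)"
    for f :: "('k, 'v) words \<Rightarrow> ('k, 'v) words"
    using that pm.vector_space_axioms unfolding Vector_Spaces.linear_iff by blast
  have alg: "As2_diff_algebra scale_pm mult d"
  proof (intro As2_diff_algebra.intro As2_algebra.intro As2_algebra_axioms.intro
      As2_diff_algebra_axioms.intro pm.vector_space_axioms)
    fix a b c x y z
    show "Vector_Spaces.linear scale_pm scale_pm (\<lambda>y. mult x y)"
      "Vector_Spaces.linear scale_pm scale_pm (\<lambda>x. mult x y)"
      "Vector_Spaces.linear scale_pm scale_pm d"
      by (rule lin; simp add: mult_def d_def \<eta>_simps dif_add dif_scale distrib_left distrib_right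
          scale_mult_left scale_mult_right \<pi>.add \<pi>.scale)+
    have mult3: "mult (mult x y) z = \<pi> (\<eta> x * \<eta> y * \<eta> z)" for x y z
      unfolding mult_def by (rule left) (rule aug)
    show "mult (mult x y) z = mult x (mult y z)"
      unfolding mult3 unfolding mult_def by (simp add: right aug mult.assoc)
    show "mult (mult a b) c - mult (mult b a) c - mult (mult a c) b + mult (mult c a) b
        + mult (mult b c) a - mult (mult c b) a = 0"
      using \<pi>(3)[OF standard3_null[OF \<eta>_aug \<eta>_aug \<eta>_aug], of a b c]
      by (simp add: mult3 standard3_def \<pi>.add \<pi>.diff)
    show "d (mult x y) = mult (d x) y + mult x (d y)"
      unfolding mult_def d_def by (simp add: dif left right aug dif_mult \<pi>.add)
  qed
  have letter: "mono [(v, 0)] \<in> homogeneous (-1)" "mono [(v, 0)] \<in> augmentation_ideal" for v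
    by (simp_all add: augmentation_ideal_def)
  have same: "\<pi> f = \<pi> g" if "f \<in> homogeneous (-1)" "g \<in> homogeneous (-1)" "ev f = ev g" for f g
    using same_value_null[OF that] by (rule \<pi>_eqI)
  have "\<phi> (a + b) = \<phi> a + \<phi> b" for a b
    unfolding \<phi>_def \<pi>.add[symmetric]
    by (intro same pm.subspace_add[OF subspace_supported] letter) (simp only: lin_ext_add[OF module_scale] ev_letter)
  moreover have "\<phi> (scale c a) = scale_pm c (\<phi> a)" for a c
    unfolding \<phi>_def \<pi>.scale[symmetric]
    by (intro same pm.subspace_scale[OF subspace_supported] letter)
      (simp only: lin_ext_scale[OF module_scale] ev_letter)
  ultimately have lin\<phi>: "Vector_Spaces.linear scale scale_pm \<phi>"
    unfolding Vector_Spaces.linear_iff using vector_space_axioms pm.vector_space_axioms by blast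
  have inj: "inj \<phi>"
  proof (rule injI)
    fix a b assume "\<phi> a = \<phi> b"
    then have "mono [(a, 0)] - mono [(b, 0)] \<in> null_ideal"
      using \<pi>(2)[of "mono [(a, 0)] - mono [(b, 0)]"] by (simp add: \<phi>_def \<pi>.diff)
    then have "ev (1 * (dif ^^ 0) (mono [(a, 0)] - mono [(b, 0)]) * 1) = 0"
      unfolding null_ideal_def by blast
    then show "a = b" by (simp add: ext_simps)
  qed
  note simps = mult_def d_def \<phi>_def dif left right letter dif_augmentation
  have "\<phi> (succ a b) = mult (d (\<phi> a)) (\<phi> b)" for a b
  proof -
    have "\<phi> (succ a b) = \<pi> (dif (mono [(a, 0)]) * mono [(b, 0)])"
      unfolding \<phi>_def
    proof (rule same[OF letter(1)])
      show "dif (mono [(a, 0)]) * mono [(b, 0)] \<in> (homogeneous (-1) :: ('k, 'v) words set)"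
        by (simp add: dif_mono)
    qed (simp add: ev_succ letter del: supported_mono)
    then show ?thesis by (simp add: simps)
  qed
  moreover have "\<phi> (prec a b) = mult (\<phi> a) (d (\<phi> b))" for a b
  proof -
    have "\<phi> (prec a b) = \<pi> (mono [(a, 0)] * dif (mono [(b, 0)]))"
      unfolding \<phi>_def
    proof (rule same[OF letter(1)])
      show "mono [(a, 0)] * dif (mono [(b, 0)]) \<in> (homogeneous (-1) :: ('k, 'v) words set)"
        by (simp add: dif_mono)
    qed (simp add: ev_prec letter del: supported_mono)
    then show ?thesis by (simp add: simps)
  qed
  ultimately show ?thesis
    using alg lin\<phi> inj
    by (intro exI[of _ scale_pm] exI[of _ mult] exI[of _ d] exI[of _ \<phi>]) simp
qed

end

theorem proposition6:
  fixes scale :: "'k::field_char_0 \<Rightarrow> 'v::ab_group_add \<Rightarrow> 'v"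
    and succ prec :: "'v \<Rightarrow> 'v \<Rightarrow> 'v"
  assumes "Der_As2_algebra scale succ prec"
  shows "\<exists>(scaleA :: 'k \<Rightarrow> ('k, 'v) envelope \<Rightarrow> ('k, 'v) envelope) mult d \<phi>.
           As2_diff_algebra scaleA mult d \<and>
           Vector_Spaces.linear scale scaleA \<phi> \<and> inj \<phi> \<and>
           (\<forall>a b. \<phi> (succ a b) = mult (d (\<phi> a)) (\<phi> b)) \<and>
           (\<forall>a b. \<phi> (prec a b) = mult (\<phi> a) (d (\<phi> b)))"
  using Der_As2_algebra.embedding[OF assms] .

end
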